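(* Let $a,b\in\mathbb{C}$, $c\in\mathbb{C}\setminus-\mathbb{N}_0$, and $x\in(1,\infty)$. Then, for the upper sign chosen everywhere as well as for the lower sign chosen everywhere, $${}_2F_1(a,b;c;x\pm i0)=\frac{\Gamma(c)\Gamma(b-a)}{\Gamma(b)\Gamma(c-a)}e^{\pm i\pi a}x^{-a}{}_2F_1\!\left(a,a-c+1;a-b+1;\frac1x\right)+\frac{\Gamma(c)\Gamma(a-b)}{\Gamma(a)\Gamma(c-b)}e^{\pm i\pi b}x^{-b}{}_2F_1\!\left(b,b-c+1;b-a+1;\frac1x\right).$$
   Context: $-\mathbb{N}_0=\{0,-1,-2,\dots\}$, and $\Gamma$ is the gamma function. ${}_2F_1(a,b;c;w)$ is the Gauss hypergeometric function, principal branch on $\mathbb{C}\setminus[1,\infty)$ (the analytic continuation of $\sum_{n\ge0}\frac{(a)_n(b)_n}{(c)_n}\frac{w^n}{n!}$, $|w|<1$, where $(a)_n=a(a+1)\cdots(a+n-1)$). For $x>1$, ${}_2F_1(a,b;c;x\pm i0)=\lim_{\epsilon\to0^+}{}_2F_1(a,b;c;x\pm i\epsilon)$ are the limiting values on the branch cut $[1,\infty)$ from above and below.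
   Formalization: When a−b is an integer, the right-hand side is undefined as written (a gamma pole in Γ(b−a) or Γ(a−b)); there it is read as the limit as (a′,b′)→(a,b) with a′−b′ not an integer. For all other a, b the identity is as written. *)

theory Defs
  imports "HOL-Complex_Analysis.Complex_Analysis"
begin

(* The conditions determine F off the cut (identity theorem on a connected open set).
   Values on the cut [1,oo) itself are unspecified, and only parameters c outside
   \<int>\<^sub>\<le>\<^sub>0 are meaningful. *)
definition hyp2f1 :: "complex \<Rightarrow> complex \<Rightarrow> complex \<Rightarrow> complex \<Rightarrow> complex" where
  "hyp2f1 a b c = (SOME F.
     F holomorphic_on (- complex_of_real ` {1..}) \<and>
     (\<forall>w\<in>ball 0 1.
        (\<lambda>n. pochhammer a n * pochhammer b n / pochhammer c n * (w ^ n / fact n)) sums F w))"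

end

theory Submission
  imports Defs "HOL-Real_Asymp.Real_Asymp"
begin

section \<open>Limiting values of the hypergeometric function on its branch cut\<close>

text \<open>
  In the coordinate \<open>\<zeta>\<close> with \<open>w = - exp \<zeta>\<close>, let \<open>f\<close> be the series at \<open>w = 0\<close> and \<open>u, v\<close> the two
  solutions at infinity. If \<open>Re (c - a - b) > 3\<close>, all three series and their first two derivatives
  converge up to the unit circle, so on the arc \<open>\<bar>w\<bar> = 1\<close>, \<open>w \<noteq> 1\<close> they solve the same second-order
  equation, and constancy of the Wronskians gives \<open>f = \<alpha> u + \<beta> v\<close> there. The coefficients follow from the
  two endpoints \<open>w = 1 \<plusminus> i0\<close> of the arc by Gauss' summation theorem, and pasting \<open>f\<close> and
  \<open>\<alpha> u + \<beta> v\<close> across the circle gives the continuation of \<open>f\<close>. Contiguous relations in \<open>c\<close>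
  remove the restriction on \<open>c\<close>. If \<open>a - b\<close> is an integer, the mean value of the continuation over
  \<open>(a + t, b - t)\<close>, \<open>\<bar>t\<bar> = 1/8\<close>, reproduces it, which shows continuity in the parameters.
\<close>

subsection \<open>Coefficients and convergence\<close>

text \<open>The expansions at 0 and at infinity converge on regions that share only the unit circle,
  so no open overlap exists in which to compare them; convergence on the circle itself is needed.
  One number governs it: the series in u has parameters (a, a - c + 1; a - b + 1), and its excess (a
  - b + 1) - a - (a - c + 1) = c - a - b is that of f; likewise for v. Raising c improves all three
  series at once and leaves a - b alone. Two parameter shifts occur. (a + s, b + s) keeps a - b and
  escapes zeros of reciprocal Gamma factors. (a + t, b - t) moves a - b by 2 t and escapes the
  integers, so the cancelling poles of the two terms never have to be expanded; this requires a
  continuation that is continuous in (a, b) on a whole bounded set. The values on the cut need no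
  separate analysis: the expansion at infinity is holomorphic on all of Re \<zeta> > 0, and the
  edges Im \<zeta> = pi and Im \<zeta> = -pi of the strip are the two sides of the cut.\<close>

definition hyp_coeff :: "complex \<Rightarrow> complex \<Rightarrow> complex \<Rightarrow> nat \<Rightarrow> complex" where
  "hyp_coeff a b c n = pochhammer a n * pochhammer b n / (pochhammer c n * fact n)"

definition hyp_series :: "complex \<Rightarrow> complex \<Rightarrow> complex \<Rightarrow> complex \<Rightarrow> complex" where
  "hyp_series a b c w = (\<Sum>n. hyp_coeff a b c n * w ^ n)"

lemma minus_notin_Ints_commute: "a - b \<notin> \<int> \<Longrightarrow> b - a \<notin> (\<int> :: complex set)"
  by (metis Ints_minus minus_diff_eq)

lemma add_of_nat_neq_0: "c \<notin> \<int>\<^sub>\<le>\<^sub>0 \<Longrightarrow> c + of_nat n \<noteq> (0::complex)"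
  by (metis add_eq_0_iff2 minus_of_nat_in_nonpos_Ints)

lemma pochhammer_neq_0: "c \<notin> \<int>\<^sub>\<le>\<^sub>0 \<Longrightarrow> pochhammer c n \<noteq> (0::complex)"
  by (metis pochhammer_eq_0_iff minus_of_nat_in_nonpos_Ints)

lemma hyp_coeff_0 [simp]: "hyp_coeff a b c 0 = 1"
  by (simp add: hyp_coeff_def)

lemma hyp_coeff_Suc:
  "hyp_coeff a b c (Suc n) =
     hyp_coeff a b c n * ((a + of_nat n) * (b + of_nat n) / ((c + of_nat n) * of_nat (Suc n)))"
  by (simp add: hyp_coeff_def pochhammer_Suc mult_ac)

lemma hyp_coeff_rec:
  assumes "c \<notin> \<int>\<^sub>\<le>\<^sub>0"
  shows "(c + of_nat n) * of_nat (Suc n) * hyp_coeff a b c (Suc n) =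
     (a + of_nat n) * (b + of_nat n) * hyp_coeff a b c n"
  using add_of_nat_neq_0[OF assms, of n] by (simp add: hyp_coeff_Suc del: of_nat_Suc)

lemma hyp_coeff_commute: "hyp_coeff a b c n = hyp_coeff b a c n"
  by (simp add: hyp_coeff_def)

lemma tendsto_pochhammer:
  fixes f :: "_ \<Rightarrow> complex"
  shows "(f \<longlongrightarrow> a) F \<Longrightarrow> ((\<lambda>x. pochhammer (f x) n) \<longlongrightarrow> pochhammer a n) F"
  unfolding pochhammer_prod by (intro tendsto_intros)

lemma tendsto_hyp_coeff [tendsto_intros]:
  assumes "(\<alpha> \<longlongrightarrow> a) F" "(\<beta> \<longlongrightarrow> b) F" "(\<gamma> \<longlongrightarrow> c) F" "c \<notin> \<int>\<^sub>\<le>\<^sub>0"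
  shows "((\<lambda>x. hyp_coeff (\<alpha> x) (\<beta> x) (\<gamma> x) n) \<longlongrightarrow> hyp_coeff a b c n) F"
  unfolding hyp_coeff_def
  by (intro tendsto_intros tendsto_pochhammer assms) (simp add: pochhammer_neq_0 assms)

text \<open>This is the AM-GM inequality for \<open>\<bar>a + n\<bar>\<^sup>2 / n\<close> and \<open>n\<close>.\<close>
lemma norm_add_of_nat_le:
  assumes "n > 0" "Re a \<le> p" "norm a ^ 2 \<le> 2 * K"
  shows "norm (a + of_nat n) \<le> real n + p + K / real n"
proof -
  have sq: "norm (a + of_nat n) ^ 2 = real n ^ 2 + 2 * real n * Re a + norm a ^ 2"
    by (simp only: cmod_power2) (simp add: power2_eq_square algebra_simps)
  have "2 * real n * norm (a + of_nat n) \<le> norm (a + of_nat n) ^ 2 + real n ^ 2"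
    using sum_squares_bound[of "norm (a + of_nat n)" "real n"] by (simp add: mult_ac)
  also have "\<dots> \<le> 2 * real n ^ 2 + 2 * real n * p + 2 * K"
    unfolding sq using assms mult_left_mono[OF assms(2), of "2 * real n"] by linarith
  also have "\<dots> = 2 * real n * (real n + p + K / real n)"
    using assms by (simp add: power2_eq_square field_simps)
  finally show ?thesis using assms by simp
qed

text \<open>The left side is 1 + (p + p' - r - 1) / n + O(1 / n^2), the right side 1 + q / n + O(1 /
  n^2), and the hypothesis separates the two 1 / n terms. It compares quotients of consecutive
  coefficients with those of (n + 1) powr q.\<close>

lemma ratio_bound_asymp:
  fixes p p' K r q :: real
  assumes "p + p' < r + q + 1"
  shows "eventually (\<lambda>n. real n + r > 0 \<and>
           (real n + p + K / real n) * (real n + p' + K / real n) / ((real n + r) * (real n + 1))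
            \<le> ((real n + 2) / (real n + 1)) powr q) at_top"
proof -
  \<comment> \<open>The difference of the two 1 / n terms is e / n; with \<open>q\<close> written
    through \<open>e\<close>, only e > 0 has to be known.\<close>
  define e where "e = r + q + 1 - p - p'"
  have e: "e > 0" "q = e + p + p' - r - 1" using assms by (auto simp: e_def)
  show ?thesis unfolding eventually_conj_iff e(2) using e(1) by (intro conjI; real_asymp)
qed

text \<open>One constant serves all parameters close to the limit, which is what dominated
  convergence in the parameters needs. Beyond some \<open>N\<close> the quotients of consecutive
  coefficients are controlled; the finitely many earlier coefficients converge.\<close>

lemma hyp_coeff_bound:
  assumes lim: "(\<alpha> \<longlongrightarrow> a) F" "(\<beta> \<longlongrightarrow> b) F" "(\<gamma> \<longlongrightarrow> c) F" and c: "c \<notin> \<int>\<^sub>\<le>\<^sub>0"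
    and q: "q > Re (a + b - c) - 1"
  obtains C where "C > 0"
    "eventually (\<lambda>x. \<forall>n. norm (hyp_coeff (\<alpha> x) (\<beta> x) (\<gamma> x) n) \<le> C * (real n + 1) powr q) F"
proof -
  \<comment> \<open>A quarter of the slack: each of three parameters may stray by \<open>e\<close>,
    which uses 3 e out of 4 e.\<close>
  define e where "e = (q + 1 - Re (a + b - c)) / 4"
  have e: "e > 0" using q by (simp add: e_def)
  define K where "K = max ((norm a + 1)^2) ((norm b + 1)^2)"
  have K: "(norm a + 1)^2 \<le> 2 * K" "(norm b + 1)^2 \<le> 2 * K"
  proof -
    have "K \<ge> (norm a + 1)^2" "K \<ge> (norm b + 1)^2" by (simp_all only: K_def max.cobounded1 max.cobounded2)
    moreover have "(norm a + 1)^2 \<ge> 0" by (rule zero_le_power2)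
    ultimately show "(norm a + 1)^2 \<le> 2 * K" "(norm b + 1)^2 \<le> 2 * K" by linarith+
  qed
  have ev: "eventually (\<lambda>x. Re (\<alpha> x) < Re a + e) F" "eventually (\<lambda>x. Re (\<beta> x) < Re b + e) F"
     "eventually (\<lambda>x. Re (\<gamma> x) > Re c - e) F"
     "eventually (\<lambda>x. norm (\<alpha> x) < norm a + 1) F" "eventually (\<lambda>x. norm (\<beta> x) < norm b + 1) F"
    using e by (intro order_tendstoD[OF tendsto_Re[OF lim(1)]] order_tendstoD[OF tendsto_Re[OF lim(2)]]
        order_tendstoD[OF tendsto_Re[OF lim(3)]] order_tendstoD[OF tendsto_norm[OF lim(1)]]
        order_tendstoD[OF tendsto_norm[OF lim(2)]]; simp)+
  have "Re a + e + (Re b + e) < Re c - e + q + 1"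
    using e by (simp add: e_def field_simps)
  from eventually_conj[OF ratio_bound_asymp[OF this, of K] eventually_gt_at_top[of 0]]
  obtain N where N: "\<And>n. n \<ge> N \<Longrightarrow> n > 0 \<and> real n + (Re c - e) > 0 \<and>
           (real n + (Re a + e) + K / real n) * (real n + (Re b + e) + K / real n) / ((real n + (Re c - e)) * (real n + 1))
            \<le> ((real n + 2) / (real n + 1)) powr q"
    by (auto simp: eventually_at_top_linorder)
  \<comment> \<open>\<open>C\<close> takes care of the indices up to \<open>N\<close>; the added 1
    leaves room for perturbed parameters.\<close>
  define C where "C = (\<Sum>n\<le>N. (norm (hyp_coeff a b c n) + 1) / (real n + 1) powr q)"
  have C: "norm (hyp_coeff a b c n) + 1 \<le> C * (real n + 1) powr q" if "n \<le> N" for n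
  proof -
    have "(norm (hyp_coeff a b c n) + 1) / (real n + 1) powr q \<le> C"
      unfolding C_def using that by (intro member_le_sum) auto
    thus ?thesis by (simp add: field_simps)
  qed
  have ev2: "eventually (\<lambda>x. \<forall>n\<in>{..N}. norm (hyp_coeff (\<alpha> x) (\<beta> x) (\<gamma> x) n) < norm (hyp_coeff a b c n) + 1) F"
    by (intro eventually_ball_finite ballI order_tendstoD[OF tendsto_norm[OF tendsto_hyp_coeff[OF lim c]]]) auto
  have "eventually (\<lambda>x. \<forall>n. norm (hyp_coeff (\<alpha> x) (\<beta> x) (\<gamma> x) n) \<le> C * (real n + 1) powr q) F"
    using ev ev2
  proof eventually_elim
    case (elim x)
    show ?case
    proof
      fix n
      show "norm (hyp_coeff (\<alpha> x) (\<beta> x) (\<gamma> x) n) \<le> C * (real n + 1) powr q"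
      proof (cases "n \<le> N")
        case True
        have "norm (hyp_coeff (\<alpha> x) (\<beta> x) (\<gamma> x) n) < norm (hyp_coeff a b c n) + 1"
          using elim(6) True by blast
        thus ?thesis using C[OF True] by linarith
      next
        case False
        hence "n \<ge> N" by simp
        thus ?thesis
        proof (induction n rule: dec_induct)
          case base
          have "norm (hyp_coeff (\<alpha> x) (\<beta> x) (\<gamma> x) N) < norm (hyp_coeff a b c N) + 1"
            using elim(6) by blast
          thus ?case using C[of N] by linarith
        next
          case (step n)
          note Nn = N[OF step(1)]
          have sqa: "(norm (\<alpha> x))\<^sup>2 \<le> 2 * K"
            using power_strict_mono[OF elim(4) norm_ge_zero pos2] K(1) by (rule order.trans[OF less_imp_le])
          have sqb: "(norm (\<beta> x))\<^sup>2 \<le> 2 * K"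
            using power_strict_mono[OF elim(5) norm_ge_zero pos2] K(2) by (rule order.trans[OF less_imp_le])
          have na: "norm (\<alpha> x + of_nat n) \<le> real n + (Re a + e) + K / real n"
            by (rule norm_add_of_nat_le) (use Nn elim(1) sqa in auto)
          have nb: "norm (\<beta> x + of_nat n) \<le> real n + (Re b + e) + K / real n"
            by (rule norm_add_of_nat_le) (use Nn elim(2) sqb in auto)
          have nc: "norm (\<gamma> x + of_nat n) \<ge> real n + (Re c - e)"
            using elim(3) complex_Re_le_cmod[of "\<gamma> x + of_nat n"] by simp
          have n1: "norm (of_nat (Suc n) :: complex) = real n + 1"
            by (simp only: norm_of_nat)
          have "norm ((\<alpha> x + of_nat n) * (\<beta> x + of_nat n) / ((\<gamma> x + of_nat n) * of_nat (Suc n)))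
             \<le> (real n + (Re a + e) + K / real n) * (real n + (Re b + e) + K / real n) / ((real n + (Re c - e)) * (real n + 1))"
            unfolding norm_mult norm_divide n1
          proof (rule frac_le)
            have pa: "0 \<le> real n + (Re a + e) + K / real n"
              using na norm_ge_zero order_trans by blast
            show "norm (\<alpha> x + of_nat n) * norm (\<beta> x + of_nat n)
              \<le> (real n + (Re a + e) + K / real n) * (real n + (Re b + e) + K / real n)"
              by (rule mult_mono[OF na nb pa]) simp
            show "0 < (real n + (Re c - e)) * (real n + 1)" using Nn by simp
            show "(real n + (Re c - e)) * (real n + 1) \<le> norm (\<gamma> x + of_nat n) * (real n + 1)"
              using nc by (rule mult_right_mono) simp
            show "0 \<le> (real n + (Re a + e) + K / real n) * (real n + (Re b + e) + K / real n)"
              using pa nb norm_ge_zero order_trans mult_nonneg_nonneg by blast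
          qed
          also have "\<dots> \<le> ((real n + 2) / (real n + 1)) powr q" using Nn by simp
          finally have r: "norm ((\<alpha> x + of_nat n) * (\<beta> x + of_nat n) / ((\<gamma> x + of_nat n) * of_nat (Suc n)))
                  \<le> ((real n + 2) / (real n + 1)) powr q" .
          have "norm (hyp_coeff (\<alpha> x) (\<beta> x) (\<gamma> x) (Suc n)) \<le> 
              (C * (real n + 1) powr q) * ((real n + 2) / (real n + 1)) powr q"
            unfolding hyp_coeff_Suc norm_mult[of "hyp_coeff _ _ _ _"]
            by (intro mult_mono[OF step(3) r]) (use order_trans[OF norm_ge_zero step(3)] in auto)
          also have "\<dots> = C * (real (Suc n) + 1) powr q"
            by (simp add: powr_divide add.commute)
          finally show ?case .
        qed
      qed
    qed
  qed
  moreover have "C > 0" using C[of 0] by simp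
  ultimately show ?thesis using that by blast
qed

lemma hyp_coeff_bound_fixed:
  assumes "c \<notin> \<int>\<^sub>\<le>\<^sub>0" "q > Re (a + b - c) - 1"
  obtains C where "C > 0" "\<And>n. norm (hyp_coeff a b c n) \<le> C * (real n + 1) powr q"
proof -
  obtain C where "C > 0" "eventually (\<lambda>x::nat. \<forall>n. norm (hyp_coeff a b c n) \<le> C * (real n + 1) powr q) sequentially"
    by (rule hyp_coeff_bound[of "\<lambda>_::nat. a" a sequentially "\<lambda>_. b" b "\<lambda>_. c" c q]) (use assms in auto)
  thus ?thesis using that by auto
qed

section \<open>Majorants, and joint continuity of the series in parameters and argument\<close>

lemma summable_powr_real_shift: "q < -1 \<Longrightarrow> summable (\<lambda>n. (real n + 1) powr q)"
  using summable_Suc_iff[of "\<lambda>n. real n powr q"] summable_real_powr_iff[of q]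
  by (simp add: add.commute)

lemma summable_powr_mult_power:
  fixes z :: real
  assumes z: "0 \<le> z" "z < 1"
  shows "summable (\<lambda>n. (real n + 1) powr q * z ^ n)"
proof -
  define d where "d = (z + 1) / 2"
  have d: "z < d" "d < 1" "d > 0" using z by (auto simp: d_def)
  have "((\<lambda>n. ((real n + 2) / (real n + 1)) powr q * z) \<longlongrightarrow> z) at_top"
    by real_asymp
  from order_tendstoD(2)[OF this d(1)]
  obtain N where N: "\<And>n. n \<ge> N \<Longrightarrow> ((real n + 2) / (real n + 1)) powr q * z < d"
    by (auto simp: eventually_at_top_linorder)
  show ?thesis
  proof (rule summable_ratio_test[OF d(2)])
    fix n assume "n \<ge> N"
    have "(real (Suc n) + 1) powr q * z ^ Suc n = (((real n + 2) / (real n + 1)) powr q * z) * ((real n + 1) powr q * z ^ n)"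
      by (simp add: powr_divide add.commute)
    also have "\<dots> \<le> d * ((real n + 1) powr q * z ^ n)"
      using N[OF \<open>n \<ge> N\<close>] z by (intro mult_right_mono) auto
    finally show "norm ((real (Suc n) + 1) powr q * z ^ Suc n) \<le> d * norm ((real n + 1) powr q * z ^ n)"
      using z by (simp add: abs_mult)
  qed
qed

text \<open>Tannery's theorem with two majorants: a geometric one inside the disc, and a power of n
  when the excess is positive. In the second case the limit may lie on the circle, so the moving
  argument has to stay in the closed disc.\<close>

lemma hyp_series_tendsto:
  assumes lim: "(\<alpha> \<longlongrightarrow> a) F" "(\<beta> \<longlongrightarrow> b) F" "(\<gamma> \<longlongrightarrow> c) F" and c: "c \<notin> \<int>\<^sub>\<le>\<^sub>0"
    and z: "(z \<longlongrightarrow> w) F"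
    and dom: "norm w < 1 \<or> Re (c - a - b) > 0 \<and> eventually (\<lambda>x. norm (z x) \<le> 1) F"
  shows "((\<lambda>x. hyp_series (\<alpha> x) (\<beta> x) (\<gamma> x) (z x)) \<longlongrightarrow> hyp_series a b c w) F"
proof (cases "F = bot")
  case False
  have "\<exists>M. summable M \<and> eventually (\<lambda>x. \<forall>n. norm (hyp_coeff (\<alpha> x) (\<beta> x) (\<gamma> x) n * z x ^ n) \<le> M n) F"
    using dom
  proof
    assume w: "norm w < 1"
    define \<rho> where "\<rho> = (norm w + 1) / 2"
    have \<rho>: "0 \<le> \<rho>" "norm w < \<rho>" "\<rho> < 1" using w by (auto simp: \<rho>_def)
    define q where "q = Re (a + b - c)"
    obtain C where C: "C > 0"
      "eventually (\<lambda>x. \<forall>n. norm (hyp_coeff (\<alpha> x) (\<beta> x) (\<gamma> x) n) \<le> C * (real n + 1) powr q) F"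
      by (rule hyp_coeff_bound[OF lim c, of q]) (auto simp: q_def)
    have "eventually (\<lambda>x. norm (z x) < \<rho>) F"
      using order_tendstoD(2)[OF tendsto_norm[OF z] \<rho>(2)] .
    with C(2) have "eventually (\<lambda>x. \<forall>n. norm (hyp_coeff (\<alpha> x) (\<beta> x) (\<gamma> x) n * z x ^ n) \<le> C * ((real n + 1) powr q * \<rho> ^ n)) F"
    proof eventually_elim
      case (elim x)
      have "norm (hyp_coeff (\<alpha> x) (\<beta> x) (\<gamma> x) n) * norm (z x) ^ n \<le> (C * (real n + 1) powr q) * \<rho> ^ n" for n
        using elim C(1) \<rho> by (intro mult_mono power_mono) auto
      thus ?case by (simp add: norm_mult norm_power mult_ac)
    qed
    thus ?thesis using summable_mult[OF summable_powr_mult_power[OF \<rho>(1,3), of q], of C] by blast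
  next
    assume *: "Re (c - a - b) > 0 \<and> eventually (\<lambda>x. norm (z x) \<le> 1) F"
    \<comment> \<open>The midpoint of Re (a + b - c) - 1, above which the coefficient bound holds,
      and -1, below which the powers are summable.\<close>
    define q where "q = Re (a + b - c) / 2 - 1"
    obtain C where C: "C > 0"
      "eventually (\<lambda>x. \<forall>n. norm (hyp_coeff (\<alpha> x) (\<beta> x) (\<gamma> x) n) \<le> C * (real n + 1) powr q) F"
      by (rule hyp_coeff_bound[OF lim c, of q]) (use * in \<open>auto simp: q_def\<close>)
    from C(2) conjunct2[OF *]
    have "eventually (\<lambda>x. \<forall>n. norm (hyp_coeff (\<alpha> x) (\<beta> x) (\<gamma> x) n * z x ^ n) \<le> C * (real n + 1) powr q) F"
    proof eventually_elim
      case (elim x)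
      have "norm (hyp_coeff (\<alpha> x) (\<beta> x) (\<gamma> x) n) * norm (z x) ^ n \<le> (C * (real n + 1) powr q) * 1" for n
        using elim C(1) by (intro mult_mono power_le_one) auto
      thus ?case by (simp add: norm_mult norm_power mult_ac)
    qed
    moreover have "summable (\<lambda>n. C * (real n + 1) powr q)"
      by (intro summable_mult summable_powr_real_shift) (use * in \<open>auto simp: q_def\<close>)
    ultimately show ?thesis by blast
  qed
  then obtain M where M: "summable M"
    "eventually (\<lambda>x. \<forall>n. norm (hyp_coeff (\<alpha> x) (\<beta> x) (\<gamma> x) n * z x ^ n) \<le> M n) F" by blast
  show ?thesis unfolding hyp_series_def
  proof (rule tannerys_theorem[THEN conjunct2, THEN conjunct2])
    show "((\<lambda>x. hyp_coeff (\<alpha> x) (\<beta> x) (\<gamma> x) k * z x ^ k) \<longlongrightarrow> hyp_coeff a b c k * w ^ k) F" for k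
      by (intro tendsto_intros lim z c)
    show "\<forall>\<^sub>F (k, x) in sequentially \<times>\<^sub>F F. norm (hyp_coeff (\<alpha> x) (\<beta> x) (\<gamma> x) k * z x ^ k) \<le> M k"
      using eventually_prodI[OF always_eventually[of "\<lambda>_. True"] M(2), of sequentially]
      by (rule eventually_mono) auto
  qed (use M False in auto)
qed auto

lemma summable_hyp_series:
  assumes "c \<notin> \<int>\<^sub>\<le>\<^sub>0" "norm w < 1 \<or> Re (c - a - b) > 0 \<and> norm w \<le> 1"
  shows "summable (\<lambda>n. norm (hyp_coeff a b c n * w ^ n))"
  using assms(2)
proof
  assume w: "norm w < 1"
  obtain C where C: "C > 0" "\<And>n. norm (hyp_coeff a b c n) \<le> C * (real n + 1) powr Re (a + b - c)"
    by (rule hyp_coeff_bound_fixed[OF assms(1), of a b "Re (a + b - c)"]) auto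
  show ?thesis
  proof (rule summable_comparison_test'[OF summable_mult[OF summable_powr_mult_power[OF _ w]]])
    show "norm (norm (hyp_coeff a b c n * w ^ n)) \<le> C * ((real n + 1) powr Re (a + b - c) * norm w ^ n)" for n
      using mult_right_mono[OF C(2)[of n], of "norm w ^ n"] by (simp add: norm_mult norm_power mult_ac)
  qed auto
next
  assume *: "Re (c - a - b) > 0 \<and> norm w \<le> 1"
  define q where "q = Re (a + b - c) / 2 - 1"
  obtain C where C: "C > 0" "\<And>n. norm (hyp_coeff a b c n) \<le> C * (real n + 1) powr q"
    by (rule hyp_coeff_bound_fixed[OF assms(1), of a b q]) (use * in \<open>auto simp: q_def\<close>)
  show ?thesis
  proof (rule summable_comparison_test'[OF summable_mult[OF summable_powr_real_shift[of q]]])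
    show "norm (norm (hyp_coeff a b c n * w ^ n)) \<le> C * ((real n + 1) powr q)" for n
      using mult_mono[OF C(2)[of n], of "norm w ^ n" 1] * C(1) by (simp add: norm_mult norm_power power_le_one)
  qed (use * in \<open>auto simp: q_def\<close>)
qed

lemma hyp_series_sums:
  assumes "c \<notin> \<int>\<^sub>\<le>\<^sub>0" "norm w < 1 \<or> Re (c - a - b) > 0 \<and> norm w \<le> 1"
  shows "(\<lambda>n. hyp_coeff a b c n * w ^ n) sums hyp_series a b c w"
  using summable_norm_cancel[OF summable_hyp_series[OF assms]] by (simp add: hyp_series_def summable_sums)

subsection \<open>The differential equation and its Wronskians\<close>

text \<open>The k-th derivative in \<zeta>, taken term by term: (- exp \<zeta>) ^ n is an
  eigenfunction with eigenvalue n, so no exponents shift.\<close>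

definition hyp_deriv :: "complex \<Rightarrow> complex \<Rightarrow> complex \<Rightarrow> nat \<Rightarrow> complex \<Rightarrow> complex" where
  "hyp_deriv a b c k \<zeta> = (\<Sum>n. of_nat n ^ k * hyp_coeff a b c n * (- exp \<zeta>) ^ n)"

lemma hyp_deriv_0: "hyp_deriv a b c 0 \<zeta> = hyp_series a b c (- exp \<zeta>)"
  by (simp add: hyp_deriv_def hyp_series_def)

text \<open>The origin of the bound 3: excess above 3 gives coefficients O(n^-4), and the factor n^2
  of the second derivative still leaves the summable n^-2.\<close>

lemma hyp_deriv_dominated:
  assumes c: "c \<notin> \<int>\<^sub>\<le>\<^sub>0" and pos: "Re (c - a - b) > 3"
  obtains M where "summable M"
    "\<And>n k \<zeta>. k \<le> 2 \<Longrightarrow> Re \<zeta> \<le> 0 \<Longrightarrow> norm (of_nat n ^ k * hyp_coeff a b c n * (- exp \<zeta>) ^ n) \<le> M n"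
proof -
  obtain C where C: "C > 0" "\<And>n. norm (hyp_coeff a b c n) \<le> C * (real n + 1) powr (-4)"
    by (rule hyp_coeff_bound_fixed[OF c, of a b "-4"]) (use pos in auto)
  have "norm (of_nat n ^ k * hyp_coeff a b c n * (- exp \<zeta>) ^ n) \<le> C * (real n + 1) powr (-2)"
    if k: "k \<le> 2" and z: "Re \<zeta> \<le> 0" for n k \<zeta>
  proof -
    have "real n ^ k \<le> (real n + 1) ^ k" by (intro power_mono) auto
    also have "\<dots> \<le> (real n + 1) ^ 2" using k by (intro power_increasing) auto
    also have "\<dots> = (real n + 1) powr 2" by (simp add: powr_numeral)
    finally have 1: "real n ^ k \<le> (real n + 1) powr 2" .
    have 2: "exp (Re \<zeta>) ^ n \<le> 1" using z by (intro power_le_one) auto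
    have "real n ^ k * norm (hyp_coeff a b c n) * exp (Re \<zeta>) ^ n
      \<le> (real n + 1) powr 2 * (C * (real n + 1) powr (-4)) * 1"
      using 1 2 C by (intro mult_mono mult_nonneg_nonneg) auto
    also have "\<dots> = C * (real n + 1) powr (2 + -4)" unfolding powr_add by simp
    finally show ?thesis by (simp add: norm_mult norm_power)
  qed
  moreover have "summable (\<lambda>n. C * (real n + 1) powr (-2))"
    by (intro summable_mult summable_powr_real_shift) auto
  ultimately show ?thesis using that by blast
qed

lemma hyp_deriv_sums:
  assumes c: "c \<notin> \<int>\<^sub>\<le>\<^sub>0" and pos: "Re (c - a - b) > 3" and "k \<le> 2" "Re \<zeta> \<le> 0"
  shows "(\<lambda>n. of_nat n ^ k * hyp_coeff a b c n * (- exp \<zeta>) ^ n) sums hyp_deriv a b c k \<zeta>"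
proof -
  obtain M where M: "summable M"
    "\<And>n k \<zeta>. k \<le> 2 \<Longrightarrow> Re \<zeta> \<le> 0 \<Longrightarrow> norm (of_nat n ^ k * hyp_coeff a b c n * (- exp \<zeta>) ^ n) \<le> M n"
    using hyp_deriv_dominated[OF c pos] by blast
  have "summable (\<lambda>n. of_nat n ^ k * hyp_coeff a b c n * (- exp \<zeta>) ^ n)"
    by (rule summable_comparison_test'[OF M(1), of 0]) (use M(2) assms in auto)
  thus ?thesis by (simp add: hyp_deriv_def summable_sums)
qed

text \<open>Uniform convergence of the differentiated series gives derivatives within the closed
  half-plane. Its boundary, the unit circle in w, is where the Wronskians with the solutions at
  infinity are formed.\<close>

lemma has_field_derivative_hyp_deriv:
  assumes c: "c \<notin> \<int>\<^sub>\<le>\<^sub>0" and pos: "Re (c - a - b) > 3" and k: "k \<le> 1" and "Re \<zeta> \<le> 0"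
  shows "(hyp_deriv a b c k has_field_derivative hyp_deriv a b c (Suc k) \<zeta>) (at \<zeta> within {z. Re z \<le> 0})"
proof -
  define S where "S = {z. Re z \<le> 0}"
  obtain M where M: "summable M"
    "\<And>n k \<zeta>. k \<le> 2 \<Longrightarrow> Re \<zeta> \<le> 0 \<Longrightarrow> norm (of_nat n ^ k * hyp_coeff a b c n * (- exp \<zeta>) ^ n) \<le> M n"
    using hyp_deriv_dominated[OF c pos] by blast
  have "\<exists>g. \<forall>x\<in>S. (\<lambda>n. of_nat n ^ k * hyp_coeff a b c n * (- exp x) ^ n) sums g x \<and>
           (g has_field_derivative hyp_deriv a b c (Suc k) x) (at x within S)"
  proof (rule has_field_derivative_series)
    show "convex S" unfolding S_def by (rule convex_halfspace_Re_le)
    fix n x assume "x \<in> S"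
    have "((\<lambda>x. (- exp x) ^ n) has_field_derivative of_nat n * (- exp x) ^ n) (at x within S)"
    proof -
      have "((\<lambda>x. - exp x) has_field_derivative (- exp x)) (at x within S)"
        by (auto intro!: derivative_eq_intros)
      from DERIV_power[OF this, of n] show ?thesis by (cases n) auto
    qed
    from DERIV_cmult[OF this, of "of_nat n ^ k * hyp_coeff a b c n"]
    show "((\<lambda>x. of_nat n ^ k * hyp_coeff a b c n * (- exp x) ^ n) has_field_derivative
            (of_nat n ^ Suc k * hyp_coeff a b c n * (- exp x) ^ n)) (at x within S)"
      by (simp add: mult_ac)
  next
    show "uniform_limit S (\<lambda>n x. \<Sum>i<n. of_nat i ^ Suc k * hyp_coeff a b c i * (- exp x) ^ i)
       (hyp_deriv a b c (Suc k)) sequentially"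
      unfolding hyp_deriv_def
      by (rule Weierstrass_m_test[OF _ M(1)]) (use M(2) k in \<open>auto simp: S_def simp del: power_Suc\<close>)
  next
    show "\<zeta> \<in> S" using assms by (simp add: S_def)
    show "summable (\<lambda>n. of_nat n ^ k * hyp_coeff a b c n * (- exp \<zeta>) ^ n)"
      using hyp_deriv_sums[OF c pos, of k \<zeta>] assms by (auto simp: sums_iff)
  qed
  then obtain g where g: "\<And>x. x \<in> S \<Longrightarrow> (\<lambda>n. of_nat n ^ k * hyp_coeff a b c n * (- exp x) ^ n) sums g x"
    "\<And>x. x \<in> S \<Longrightarrow> (g has_field_derivative hyp_deriv a b c (Suc k) x) (at x within S)" by blast
  have "hyp_deriv a b c k x = g x" if "x \<in> S" for x
    using g(1)[OF that] by (simp add: hyp_deriv_def sums_iff)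
  moreover have "\<zeta> \<in> S" using assms by (simp add: S_def)
  ultimately show ?thesis
    unfolding S_def[symmetric] by (intro has_field_derivative_transform_within[OF g(2)[of \<zeta>] zero_less_one]) auto
qed

text \<open>In the variable \<open>\<zeta>\<close> with \<open>w = - exp \<zeta>\<close> the slit plane without \<open>[0, 1)\<close> becomes the strip
  \<open>\<bar>Im \<zeta>\<bar> < \<pi>\<close>, the unit circle becomes the imaginary axis, and \<open>w d/dw\<close> becomes \<open>d/d\<zeta>\<close>.\<close>
definition hyp_ode_on :: "complex \<Rightarrow> complex \<Rightarrow> complex \<Rightarrow> complex set \<Rightarrow> (complex \<Rightarrow> complex) \<Rightarrow> (complex \<Rightarrow> complex) \<Rightarrow> bool" where
  "hyp_ode_on a b c S u u' \<longleftrightarrow> (\<forall>z\<in>S. (u has_field_derivative u' z) (at z within S) \<and>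
     (\<exists>u''. (u' has_field_derivative u'') (at z within S) \<and>
        (1 + exp z) * u'' + (c - 1 + exp z * (a + b)) * u' z + exp z * (a * b) * u z = 0))"

lemma hyp_ode_on_subset: "hyp_ode_on a b c S u u' \<Longrightarrow> T \<subseteq> S \<Longrightarrow> hyp_ode_on a b c T u u'"
  unfolding hyp_ode_on_def by (meson has_field_derivative_subset subsetD)

text \<open>With D = d/d\<zeta> this is D (D + c - 1) f = w (D + a) (D + b) f, the
  generating-function form of \<open>hyp_coeff_rec\<close>.\<close>

lemma hyp_deriv_ode:
  assumes c: "c \<notin> \<int>\<^sub>\<le>\<^sub>0" and pos: "Re (c - a - b) > 3" and z: "Re \<zeta> \<le> 0"
  shows "(1 + exp \<zeta>) * hyp_deriv a b c 2 \<zeta> + (c - 1 + exp \<zeta> * (a + b)) * hyp_deriv a b c 1 \<zeta>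
           + exp \<zeta> * (a * b) * hyp_deriv a b c 0 \<zeta> = 0"
proof -
  define y where "y = - exp \<zeta>"
  let ?k = "hyp_coeff a b c"
  have sums: "(\<lambda>n. of_nat n ^ k * ?k n * y ^ n) sums hyp_deriv a b c k \<zeta>" if "k \<le> 2" for k
    using hyp_deriv_sums[OF c pos that z] by (simp add: y_def)
  have "(\<lambda>n. of_nat n ^ 2 * ?k n * y ^ n + (c - 1) * (of_nat n ^ 1 * ?k n * y ^ n)) sums
          (hyp_deriv a b c 2 \<zeta> + (c - 1) * hyp_deriv a b c 1 \<zeta>)"
    by (intro sums_add sums_mult sums) auto
  \<comment> \<open>The terms at n = 0 vanish, so the index can be shifted without a
    correction.\<close>
  hence "(\<lambda>n. of_nat (Suc n) ^ 2 * ?k (Suc n) * y ^ (Suc n) + (c - 1) * (of_nat (Suc n) ^ 1 * ?k (Suc n) * y ^ (Suc n)))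
       sums (hyp_deriv a b c 2 \<zeta> + (c - 1) * hyp_deriv a b c 1 \<zeta>)"
    by (subst sums_Suc_iff) simp
  also have "(\<lambda>n. of_nat (Suc n) ^ 2 * ?k (Suc n) * y ^ (Suc n) + (c - 1) * (of_nat (Suc n) ^ 1 * ?k (Suc n) * y ^ (Suc n)))
     = (\<lambda>n. y * ((c + of_nat n) * of_nat (Suc n) * ?k (Suc n)) * y ^ n)"
    by (simp add: power2_eq_square algebra_simps)
  also have "\<dots> = (\<lambda>n. y * (of_nat n ^ 2 * ?k n * y ^ n + (a + b) * (of_nat n ^ 1 * ?k n * y ^ n) + a * b * (of_nat n ^ 0 * ?k n * y ^ n)))"
    unfolding hyp_coeff_rec[OF c] by (simp add: power2_eq_square algebra_simps)
  finally have 1: "\<dots> sums (hyp_deriv a b c 2 \<zeta> + (c - 1) * hyp_deriv a b c 1 \<zeta>)" .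
  have 2: "(\<lambda>n. y * (of_nat n ^ 2 * ?k n * y ^ n + (a + b) * (of_nat n ^ 1 * ?k n * y ^ n) + a * b * (of_nat n ^ 0 * ?k n * y ^ n)))
     sums (y * (hyp_deriv a b c 2 \<zeta> + (a + b) * hyp_deriv a b c 1 \<zeta> + a * b * hyp_deriv a b c 0 \<zeta>))"
    by (intro sums_mult sums_add sums) auto
  from sums_unique2[OF 1 2] show ?thesis by (simp add: y_def algebra_simps)
qed

lemma hyp_ode_on_left:
  assumes c: "c \<notin> \<int>\<^sub>\<le>\<^sub>0" and pos: "Re (c - a - b) > 3"
  shows "hyp_ode_on a b c {z. Re z \<le> 0} (hyp_deriv a b c 0) (hyp_deriv a b c 1)"
  unfolding hyp_ode_on_def
  using has_field_derivative_hyp_deriv[OF c pos, of 0] has_field_derivative_hyp_deriv[OF c pos, of 1]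
    hyp_deriv_ode[OF c pos] by (auto simp: numeral_2_eq_2)

text \<open>The exponents at infinity are \<open>a\<close> and \<open>b\<close>; this is the solution \<open>(- w) powr (- a) F(1 / w)\<close>.\<close>
definition hyp_inf :: "complex \<Rightarrow> complex \<Rightarrow> complex \<Rightarrow> complex \<Rightarrow> complex" where
  "hyp_inf a b c \<zeta> = exp (- a * \<zeta>) * hyp_deriv a (a - c + 1) (a - b + 1) 0 (- \<zeta>)"

definition hyp_inf' :: "complex \<Rightarrow> complex \<Rightarrow> complex \<Rightarrow> complex \<Rightarrow> complex" where
  "hyp_inf' a b c \<zeta> = - exp (- a * \<zeta>) * (a * hyp_deriv a (a - c + 1) (a - b + 1) 0 (- \<zeta>)
       + hyp_deriv a (a - c + 1) (a - b + 1) 1 (- \<zeta>))"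

lemma nonint_diff: "a - b \<notin> \<int> \<Longrightarrow> (a - b + 1 :: complex) \<notin> \<int>\<^sub>\<le>\<^sub>0"
  by (metis nonpos_Ints_Int Ints_1 Ints_diff add_diff_cancel_right')

text \<open>Inversion of w is the reflection of \<zeta>. The equation of the reflected series at -z,
  multiplied by exp z and by exp (- a * z), becomes the original equation for
  \<open>hyp_inf\<close>.\<close>

lemma hyp_ode_on_right:
  assumes ab: "a - b \<notin> \<int>" and pos: "Re (c - a - b) > 3"
  shows "hyp_ode_on a b c {z. Re z \<ge> 0} (hyp_inf a b c) (hyp_inf' a b c)"
  unfolding hyp_ode_on_def
proof (intro ballI conjI)
  fix z :: complex assume z: "z \<in> {z. Re z \<ge> 0}"
  let ?h = "hyp_deriv a (a - c + 1) (a - b + 1)"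
  let ?S = "{z. Re z \<ge> 0}"
  have c': "a - b + 1 \<notin> \<int>\<^sub>\<le>\<^sub>0" using nonint_diff[OF ab] .
  \<comment> \<open>The excess of the inverted series is again c - a - b.\<close>
  have pos': "Re ((a - b + 1) - a - (a - c + 1)) > 3" using pos by simp
  have d: "((\<lambda>z. ?h k (- z)) has_field_derivative (- ?h (Suc k) (- z))) (at z within ?S)" if "k \<le> 1" for k
  proof -
    have im: "uminus ` ?S = {z. Re z \<le> 0}" 
    proof (intro equalityI subsetI)
      fix x :: complex assume "x \<in> {z. Re z \<le> 0}"
      thus "x \<in> uminus ` ?S" by (intro image_eqI[of x uminus "- x"]) auto
    qed auto
    have "((\<lambda>z. ?h k (- z)) has_field_derivative (?h (Suc k) (- z) * (-1))) (at z within ?S)"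
    proof (rule DERIV_image_chain[of "?h k" _ uminus, unfolded o_def])
      show "(?h k has_field_derivative ?h (Suc k) (- z)) (at (- z) within uminus ` ?S)"
        unfolding im by (rule has_field_derivative_hyp_deriv[OF c' pos' that]) (use z in auto)
    qed (auto intro!: derivative_eq_intros)
    thus ?thesis by simp
  qed
  note d0 = d[of 0, simplified] 
  have d1: "((\<lambda>z. ?h 1 (- z)) has_field_derivative (- ?h 2 (- z))) (at z within ?S)"
    using d[of 1] by (simp add: numeral_2_eq_2)
  show "(hyp_inf a b c has_field_derivative hyp_inf' a b c z) (at z within ?S)"
    unfolding hyp_inf_def hyp_inf'_def
    by (rule derivative_eq_intros d0 refl)+ (simp add: algebra_simps)
  define u'' where "u'' = exp (- a * z) * (a * a * ?h 0 (- z) + 2 * a * ?h 1 (- z) + ?h 2 (- z))"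
  have "(hyp_inf' a b c has_field_derivative u'') (at z within ?S)"
    unfolding hyp_inf'_def u''_def
    by (rule derivative_eq_intros d0 d1 refl)+ (simp add: algebra_simps)
  moreover have "(1 + exp z) * u'' + (c - 1 + exp z * (a + b)) * hyp_inf' a b c z + exp z * (a * b) * hyp_inf a b c z = 0"
  proof -
    define e where "e = exp z"
    have e: "exp (- z) = 1 / e" "e \<noteq> 0" by (auto simp: e_def exp_minus field_simps)
    have "(1 + 1 / e) * ?h 2 (- z) + ((a - b + 1) - 1 + 1 / e * (a + (a - c + 1))) * ?h 1 (- z)
           + 1 / e * (a * (a - c + 1)) * ?h 0 (- z) = 0"
      unfolding e(1)[symmetric] by (rule hyp_deriv_ode[OF c' pos']) (use z in auto)
    moreover have "(e + 1) * X + (e * p + q) * Y + r * V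
        = e * ((1 + 1 / e) * X + (p + 1 / e * q) * Y + 1 / e * r * V)" for p q r X Y V
      using e(2) by (simp add: field_simps)
    ultimately have "(e + 1) * ?h 2 (- z) + (e * (a - b + 1 - 1) + (a + (a - c + 1))) * ?h 1 (- z) + (a * (a - c + 1)) * ?h 0 (- z) = 0"
      by (simp only: mult_zero_right)
    hence "exp (- a * z) * ((e + 1) * ?h 2 (- z) + (e * (a - b + 1 - 1) + (a + (a - c + 1))) * ?h 1 (- z) + (a * (a - c + 1)) * ?h 0 (- z)) = 0"
      by (simp only: mult_zero_right)
    thus ?thesis unfolding u''_def hyp_inf_def hyp_inf'_def e_def[symmetric] by (simp add: algebra_simps)
  qed
  ultimately show "\<exists>u''. (hyp_inf' a b c has_field_derivative u'') (at z within ?S) \<and>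
      (1 + exp z) * u'' + (c - 1 + exp z * (a + b)) * hyp_inf' a b c z + exp z * (a * b) * hyp_inf a b c z = 0"
    by blast
qed

lemma hyp_ode_on_commute: "hyp_ode_on a b c S u u' \<longleftrightarrow> hyp_ode_on b a c S u u'"
  unfolding hyp_ode_on_def by (simp add: add.commute mult.commute)

text \<open>Keeps the principal power of 1 + exp z differentiable on the strip, where it serves as
  part of the integrating factor.\<close>

lemma one_plus_exp_not_nonpos:
  assumes "\<bar>Im z\<bar> < pi"
  shows "1 + exp z \<notin> \<real>\<^sub>\<le>\<^sub>0"
proof
  assume "1 + exp z \<in> \<real>\<^sub>\<le>\<^sub>0"
  hence *: "exp (Re z) * cos (Im z) \<le> -1" "sin (Im z) = 0"
    by (auto simp: complex_nonpos_Reals_iff Re_exp Im_exp)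
  have "Im z = 0" using *(2) assms by (metis abs_less_iff minus_less_iff sin_eq_0_pi)
  thus False using *(1) exp_gt_zero[of "Re z"] by (simp del: exp_gt_zero)
qed

text \<open>Abel's identity: the factor has logarithmic derivative (c - 1 + (a + b) exp z) / (1 +
  exp z), the negative of that of the Wronskian. Derivatives within a convex set suffice, so
  \<open>S\<close> may be a segment of the imaginary axis.\<close>

lemma wronskian_constant:
  assumes u: "hyp_ode_on a b c S u u'" and v: "hyp_ode_on a b c S v v'"
    and S: "convex S" "S \<subseteq> {z. \<bar>Im z\<bar> < pi}"
  shows "\<exists>K. \<forall>z\<in>S. (u z * v' z - u' z * v z) * (exp ((c - 1) * z) * (1 + exp z) powr (a + b + 1 - c)) = K"
proof (rule has_field_derivative_zero_constant[OF S(1)])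
  fix z assume z: "z \<in> S"
  obtain u'' where u2: "(u has_field_derivative u' z) (at z within S)" "(u' has_field_derivative u'') (at z within S)"
        "(1 + exp z) * u'' + (c - 1 + exp z * (a + b)) * u' z + exp z * (a * b) * u z = 0"
    using u z unfolding hyp_ode_on_def by blast
  obtain v'' where v2: "(v has_field_derivative v' z) (at z within S)" "(v' has_field_derivative v'') (at z within S)"
        "(1 + exp z) * v'' + (c - 1 + exp z * (a + b)) * v' z + exp z * (a * b) * v z = 0"
    using v z unfolding hyp_ode_on_def by blast
  define P where "P = (1 + exp z) powr (a + b + 1 - c)"
  define w where "w = 1 + exp z"
  have nz: "w \<notin> \<real>\<^sub>\<le>\<^sub>0" unfolding w_def by (rule one_plus_exp_not_nonpos) (use S z in auto)
  hence w0: "w \<noteq> 0" by auto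
  have "((\<lambda>z. (1 + exp z) powr (a + b + 1 - c)) has_field_derivative
         ((a + b + 1 - c) * w powr (a + b + 1 - c - 1)) * exp z) (at z within S)"
    unfolding w_def
    by (rule DERIV_chain2[of "\<lambda>w. w powr (a + b + 1 - c)" _ "\<lambda>z. 1 + exp z", OF has_field_derivative_powr])
      (use nz in \<open>auto simp: w_def intro!: derivative_eq_intros\<close>)
  also have "w powr (a + b + 1 - c - 1) = P / w"
    unfolding P_def w_def[symmetric] powr_diff[of w "a + b + 1 - c" 1] using w0 by simp
  finally have E: "((\<lambda>z. (1 + exp z) powr (a + b + 1 - c)) has_field_derivative
         ((a + b + 1 - c) * (P / w)) * exp z) (at z within S)" .
  define W where "W = u z * v' z - u' z * v z"
  define Q where "Q = exp ((c - 1) * z) * P / w"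
  have DW: "((\<lambda>z. u z * v' z - u' z * v z) has_field_derivative (u z * v'' - u'' * v z)) (at z within S)"
    by (rule derivative_eq_intros u2 v2 refl)+ (simp add: algebra_simps)
  have DX: "((\<lambda>z. exp ((c - 1) * z) * (1 + exp z) powr (a + b + 1 - c)) has_field_derivative
       (exp ((c - 1) * z) * (c - 1) * P + exp ((c - 1) * z) * (((a + b + 1 - c) * (P / w)) * exp z))) (at z within S)"
    by (rule derivative_eq_intros E refl)+ (simp add: P_def algebra_simps)
  have "((\<lambda>z. (u z * v' z - u' z * v z) * (exp ((c - 1) * z) * (1 + exp z) powr (a + b + 1 - c)))
       has_field_derivative (((u z * v'' - u'' * v z) * w + W * ((c - 1) * w + (a + b + 1 - c) * exp z)) * Q)) (at z within S)"
  proof (rule DERIV_cong[OF DERIV_mult[OF DW DX]])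
    have "D * (ex * P) + (ex * k * P + ex * (l * (P / w) * ez)) * W = (D * w + W * (k * w + l * ez)) * (ex * P / w)"
      for D ex k l ez using w0 by (simp add: field_simps)
    thus "(u z * v'' - u'' * v z) * (exp ((c - 1) * z) * (1 + exp z) powr (a + b + 1 - c)) +
      (exp ((c - 1) * z) * (c - 1) * P + exp ((c - 1) * z) * ((a + b + 1 - c) * (P / w) * exp z)) * (u z * v' z - u' z * v z)
      = ((u z * v'' - u'' * v z) * w + W * ((c - 1) * w + (a + b + 1 - c) * exp z)) * Q"
      unfolding P_def[symmetric] W_def[symmetric] Q_def .
  qed
  moreover have "(u z * v'' - u'' * v z) * w + W * ((c - 1) * w + (a + b + 1 - c) * exp z) = 0"
  proof -
    have "w * u'' = - ((c - 1 + exp z * (a + b)) * u' z + exp z * (a * b) * u z)"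
         "w * v'' = - ((c - 1 + exp z * (a + b)) * v' z + exp z * (a * b) * v z)"
      using u2(3) v2(3) unfolding w_def by (simp_all only: eq_neg_iff_add_eq_0 add.assoc)
    hence "u z * (w * v'') - (w * u'') * v z = - ((c - 1 + exp z * (a + b)) * W)"
      unfolding W_def by (simp only:) (simp add: algebra_simps)
    thus ?thesis by (simp add: w_def algebra_simps)
  qed
  ultimately show "((\<lambda>z. (u z * v' z - u' z * v z) * (exp ((c - 1) * z) * (1 + exp z) powr (a + b + 1 - c)))
       has_field_derivative 0) (at z within S)" by simp
qed

subsection \<open>Gauss' summation theorem\<close>

lemma add_of_nat_notin_nonpos_Ints:
  assumes "c \<notin> \<int>\<^sub>\<le>\<^sub>0"
  shows "c + of_nat n \<notin> (\<int>\<^sub>\<le>\<^sub>0 :: complex set)"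
proof
  assume "c + of_nat n \<in> \<int>\<^sub>\<le>\<^sub>0"
  then obtain m where "c + of_nat n = - of_nat m" by (rule nonpos_Ints_cases')
  hence "c = - of_nat (m + n)" by (simp add: algebra_simps)
  thus False using assms minus_of_nat_in_nonpos_Ints by blast
qed

lemma hyp_coeff_Suc_c:
  assumes c: "c \<notin> \<int>\<^sub>\<le>\<^sub>0"
  shows "(c + of_nat n) * hyp_coeff a b (c + 1) n = c * hyp_coeff a b c n"
proof -
  have c1: "c + 1 \<notin> \<int>\<^sub>\<le>\<^sub>0" using add_of_nat_notin_nonpos_Ints[OF c, of 1] by simp
  have "c * pochhammer (c + 1) n = (c + of_nat n) * pochhammer c n"
    using pochhammer_rec[of c n] pochhammer_rec'[of c n] by simp
  moreover have "d * (N / (q * f)) = e * (N / (p * f))"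
    if "e * q = d * p" "p \<noteq> 0" "q \<noteq> 0" for N d e f p q :: complex
  proof -
    have "d * (N / (q * f)) = (d * p) * N / (p * q * f)" by (simp add: that(2))
    also have "\<dots> = e * (N / (p * f))" unfolding that(1)[symmetric] by (simp add: that(3))
    finally show ?thesis .
  qed
  ultimately show ?thesis unfolding hyp_coeff_def
    using pochhammer_neq_0[OF c] pochhammer_neq_0[OF c1] by blast
qed

text \<open>A majorant independent of m for letting c + m tend to infinity: when Re c > 0, every
  factor of the Pochhammer symbol in the denominator grows in modulus.\<close>

lemma hyp_coeff_le_shift:
  assumes "Re c > 0"
  shows "norm (hyp_coeff a b (c + of_nat m) k) \<le> norm (hyp_coeff a b c k)"
proof -
  have "norm (pochhammer c k) \<le> norm (pochhammer (c + of_nat m) k)"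
    unfolding pochhammer_prod prod_norm[symmetric]
  proof (intro prod_mono conjI norm_ge_zero)
    fix i
    have "(Re c + real i)\<^sup>2 \<le> (Re c + real m + real i)\<^sup>2" using assms by (intro power_mono) auto
    thus "norm (c + of_nat i) \<le> norm (c + of_nat m + of_nat i)"
      by (simp add: cmod_def)
  qed
  moreover have "pochhammer c k \<noteq> 0"
    by (rule pochhammer_neq_0) (use assms in \<open>auto elim!: nonpos_Ints_cases\<close>)
  ultimately show ?thesis unfolding hyp_coeff_def norm_divide norm_mult
    by (intro divide_left_mono mult_right_mono mult_pos_pos) (auto simp: zero_less_norm_iff intro: less_le_trans)
qed

lemma hyp_coeff_shift_tendsto:
  "(\<lambda>m. hyp_coeff a b (c + of_nat m) k) \<longlonglongrightarrow> (if k = 0 then 1 else 0)"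
proof (induction k)
  case (Suc k)
  have "filterlim (\<lambda>m. (c + of_nat k) + of_nat m) at_infinity sequentially"
    by (intro tendsto_add_filterlim_at_infinity[OF tendsto_const tendsto_of_nat])
  hence "(\<lambda>m. ((a + of_nat k) * (b + of_nat k) / of_nat (Suc k)) / ((c + of_nat k) + of_nat m)) \<longlonglongrightarrow> 0"
    by (intro tendsto_divide_0[OF tendsto_const])
  from tendsto_mult[OF Suc this] show ?case
    by (simp add: hyp_coeff_Suc add_ac mult_ac)
qed auto

lemma hyp_series_1_shift_tendsto:
  "(\<lambda>m. hyp_series a b (c + of_nat m) 1) \<longlonglongrightarrow> 1"
proof -
  \<comment> \<open>Moving c by \<open>N\<close> makes its real part positive and the series at 1
    absolutely convergent; the limit does not see the offset.\<close>
  obtain N where N: "real N > \<bar>Re c\<bar>" "real N > Re (a + b - c)"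
    using reals_Archimedean2[of "max \<bar>Re c\<bar> (Re (a + b - c))"] by auto
  define c' where "c' = c + of_nat N"
  have c': "Re c' > 0" "Re (c' - a - b) > 0" using N by (auto simp: c'_def)
  hence c'': "c' \<notin> \<int>\<^sub>\<le>\<^sub>0" by (auto elim!: nonpos_Ints_cases)
  have "(\<lambda>m. \<Sum>k. hyp_coeff a b (c' + of_nat m) k * 1 ^ k) \<longlonglongrightarrow> (\<Sum>k. if k = 0 then 1 else 0)"
  proof (rule tannerys_theorem[THEN conjunct2, THEN conjunct2])
    show "(\<lambda>m. hyp_coeff a b (c' + of_nat m) k * 1 ^ k) \<longlonglongrightarrow> (if k = 0 then 1 else 0)" for k
      using hyp_coeff_shift_tendsto[of a b c' k] by simp
    show "summable (\<lambda>k. norm (hyp_coeff a b c' k))"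
      using summable_hyp_series[OF c'', of 1 a b] c' by simp
    show "\<forall>\<^sub>F (k, m) in sequentially \<times>\<^sub>F sequentially.
            norm (hyp_coeff a b (c' + of_nat m) k * 1 ^ k) \<le> norm (hyp_coeff a b c' k)"
      by (intro always_eventually) (auto simp: hyp_coeff_le_shift[OF c'(1)])
  qed simp
  also have "(\<Sum>k. if k = 0 then 1 else 0) = (1::complex)"
    using sums_single[of 0 "\<lambda>_. 1::complex"] by (simp add: sums_iff)
  finally have "(\<lambda>m. hyp_series a b (c + of_nat (m + N)) 1) \<longlonglongrightarrow> 1"
    by (simp add: hyp_series_def c'_def add_ac)
  thus ?thesis by (rule LIMSEQ_offset)
qed

text \<open>The difference of the two coefficient sequences telescopes as \<open>t n - t (n + 1)\<close> with
  \<open>t n = c n k\<^sub>n\<close>, where \<open>k\<^sub>n\<close> are the coefficients.\<close>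
lemma gauss_step:
  assumes c: "c \<notin> \<int>\<^sub>\<le>\<^sub>0" and pos: "Re (c - a - b) > 0"
  shows "c * (c - a - b) * hyp_series a b c 1 = (c - a) * (c - b) * hyp_series a b (c + 1) 1"
proof -
  have c1: "c + 1 \<notin> \<int>\<^sub>\<le>\<^sub>0" using add_of_nat_notin_nonpos_Ints[OF c, of 1] by simp
  define t where "t = (\<lambda>n. c * of_nat n * hyp_coeff a b c n)"
  note k1 = hyp_coeff_Suc_c[OF c, of _ a b]
  have eq: "c * (c - a - b) * hyp_coeff a b c n - (c - a) * (c - b) * hyp_coeff a b (c + 1) n = t n - t (Suc n)" for n
  proof -
    have cn: "c + of_nat n \<noteq> 0" by (rule add_of_nat_neq_0[OF c])
    have "(c + of_nat n) * t (Suc n) = c * ((c + of_nat n) * of_nat (Suc n) * hyp_coeff a b c (Suc n))"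
      by (simp add: t_def del: of_nat_Suc)
    also have "\<dots> = c * (a + of_nat n) * (b + of_nat n) * hyp_coeff a b c n"
      by (subst hyp_coeff_rec[OF c]) (simp only: mult_ac)
    finally have "(c + of_nat n) * (t n - t (Suc n)) = 
       (c + of_nat n) * (c * (c - a - b) * hyp_coeff a b c n) - (c - a) * (c - b) * (c * hyp_coeff a b c n)"
      by (simp add: t_def algebra_simps)
    also have "\<dots> = (c + of_nat n) * (c * (c - a - b) * hyp_coeff a b c n - (c - a) * (c - b) * hyp_coeff a b (c + 1) n)"
      unfolding k1[symmetric] by (simp add: algebra_simps)
    finally show ?thesis using cn by simp
  qed
  \<comment> \<open>With \<open>q\<close> as below, t n = O(n powr (q + 1)), and q + 1 = Re (a + b -
    c) / 2 is negative because the excess is positive.\<close>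
  have "t \<longlonglongrightarrow> 0"
  proof -
    define q where "q = Re (a + b - c) / 2 - 1"
    obtain C where C: "C > 0" "\<And>n. norm (hyp_coeff a b c n) \<le> C * (real n + 1) powr q"
      by (rule hyp_coeff_bound_fixed[OF c, of a b q]) (use pos in \<open>auto simp: q_def\<close>)
    show ?thesis
    proof (rule Lim_null_comparison)
      have "norm (t n) \<le> norm c * C * (real n + 1) powr (q + 1)" for n
      proof -
        have "norm (t n) = norm c * (real n * norm (hyp_coeff a b c n))"
          by (simp add: t_def norm_mult)
        also have "\<dots> \<le> norm c * ((real n + 1) * (C * (real n + 1) powr q))"
          by (intro mult_left_mono mult_mono C) auto
        finally show ?thesis by (simp add: powr_add mult_ac)
      qed
      thus "eventually (\<lambda>n. norm (t n) \<le> norm c * C * (real n + 1) powr (q + 1)) sequentially" by simp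
      have "q + 1 < 0" using pos by (simp add: q_def)
      thus "(\<lambda>n. norm c * C * (real n + 1) powr (q + 1)) \<longlonglongrightarrow> 0"
        by (intro tendsto_mult_right_zero tendsto_neg_powr) (auto intro: filterlim_tendsto_add_at_top filterlim_real_sequentially simp: add.commute)
    qed
  qed
  hence 1: "(\<lambda>n. t n - t (Suc n)) sums (t 0 - 0)"
    by (rule telescope_sums')
  have "(\<lambda>n. hyp_coeff a b c n * 1 ^ n) sums hyp_series a b c 1"
       "(\<lambda>n. hyp_coeff a b (c + 1) n * 1 ^ n) sums hyp_series a b (c + 1) 1"
    by (rule hyp_series_sums; use c c1 pos in simp)+
  hence 2: "(\<lambda>n. c * (c - a - b) * hyp_coeff a b c n - (c - a) * (c - b) * hyp_coeff a b (c + 1) n) sums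
      (c * (c - a - b) * hyp_series a b c 1 - (c - a) * (c - b) * hyp_series a b (c + 1) 1)"
    by (intro sums_diff sums_mult) simp_all
  from sums_unique2[OF 1[folded eq] 2] show ?thesis by (simp add: t_def)
qed

text \<open>The step is iterated without division, so vanishing factors c - a + k or c - b + k need
  no separate treatment.\<close>

lemma gauss_iterate:
  assumes c: "c \<notin> \<int>\<^sub>\<le>\<^sub>0" and pos: "Re (c - a - b) > 0"
  shows "pochhammer c n * pochhammer (c - a - b) n * hyp_series a b c 1
       = pochhammer (c - a) n * pochhammer (c - b) n * hyp_series a b (c + of_nat n) 1"
proof (induction n)
  case (Suc n)
  have "c + of_nat n \<notin> \<int>\<^sub>\<le>\<^sub>0"
    by (rule add_of_nat_notin_nonpos_Ints[OF c])
  have "pochhammer c (Suc n) * pochhammer (c - a - b) (Suc n) * hyp_series a b c 1 =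
     (c + of_nat n) * (c - a - b + of_nat n) * (pochhammer (c - a) n * pochhammer (c - b) n * hyp_series a b (c + of_nat n) 1)"
    unfolding Suc[symmetric] pochhammer_Suc by (simp only: mult_ac)
  also have "\<dots> = pochhammer (c - a) n * pochhammer (c - b) n *
       ((c + of_nat n) * (c + of_nat n - a - b) * hyp_series a b (c + of_nat n) 1)"
    by (simp add: algebra_simps)
  also have "(c + of_nat n) * (c + of_nat n - a - b) * hyp_series a b (c + of_nat n) 1
     = (c + of_nat n - a) * (c + of_nat n - b) * hyp_series a b (c + of_nat n + 1) 1"
    by (rule gauss_step) (use \<open>c + of_nat n \<notin> \<int>\<^sub>\<le>\<^sub>0\<close> pos in auto)
  finally show ?case by (simp add: pochhammer_Suc algebra_simps)
qed simp

text \<open>After the iteration both sides are matched with Gauss' products for 1 / Gamma. The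
  powers of n cancel because c + (c - a - b) = (c - a) + (c - b), and the remaining series at c + n
  + 1 tends to 1.\<close>

theorem gauss_summation:
  assumes c: "c \<notin> \<int>\<^sub>\<le>\<^sub>0" and pos: "Re (c - a - b) > 0"
  shows "hyp_series a b c 1 * rGamma c * rGamma (c - a - b) = rGamma (c - a) * rGamma (c - b)"
proof -
  have "rGamma_series c n * rGamma_series (c - a - b) n * hyp_series a b c 1
      = rGamma_series (c - a) n * rGamma_series (c - b) n * hyp_series a b (c + of_nat (n + 1)) 1" for n
  proof -
    define L where "L = complex_of_real (ln (real n))"
    have "exp (c * L) * exp ((c - a - b) * L) = exp ((c - a) * L) * exp ((c - b) * L)"
      unfolding exp_add[symmetric] by (simp add: algebra_simps)
    \<comment> \<open>\<open>rGamma_series z n\<close> contains the Pochhammer symbol of length n +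
      1.\<close>
    thus ?thesis using gauss_iterate[OF c pos, of "n + 1"]
      by (simp add: rGamma_series_def L_def[symmetric] field_simps)
  qed
  moreover have "(\<lambda>n. rGamma_series c n * rGamma_series (c - a - b) n * hyp_series a b c 1)
     \<longlonglongrightarrow> rGamma c * rGamma (c - a - b) * hyp_series a b c 1"
    by (intro tendsto_intros)
  moreover have "(\<lambda>n. rGamma_series (c - a) n * rGamma_series (c - b) n * hyp_series a b (c + of_nat (n + 1)) 1)
     \<longlonglongrightarrow> rGamma (c - a) * rGamma (c - b) * 1"
    by (intro tendsto_intros LIMSEQ_ignore_initial_segment hyp_series_1_shift_tendsto)
  ultimately have "rGamma c * rGamma (c - a - b) * hyp_series a b c 1 = rGamma (c - a) * rGamma (c - b) * 1"
    by (simp only: LIMSEQ_unique)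
  thus ?thesis by (simp add: mult_ac)
qed

subsection \<open>The connection formula on the unit circle\<close>

text \<open>Here w tends to 0 and only the constant term survives; 0 ^ k is 1 for k = 0 and 0 for
  the derivatives. It supplies the asymptotics of both solutions at infinity.\<close>

lemma hyp_deriv_at_minus_infinity:
  assumes c: "c \<notin> \<int>\<^sub>\<le>\<^sub>0" and pos: "Re (c - a - b) > 3" and k: "k \<le> 2"
  shows "((\<lambda>x. hyp_deriv a b c k (- of_real x)) \<longlongrightarrow> 0 ^ k) at_top"
proof -
  obtain M where M: "summable M"
    "\<And>n k \<zeta>. k \<le> 2 \<Longrightarrow> Re \<zeta> \<le> 0 \<Longrightarrow> norm (of_nat n ^ k * hyp_coeff a b c n * (- exp \<zeta>) ^ n) \<le> M n"
    using hyp_deriv_dominated[OF c pos] by blast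
  have "((\<lambda>x. \<Sum>n. of_nat n ^ k * hyp_coeff a b c n * (- exp (- of_real x)) ^ n) \<longlongrightarrow> (\<Sum>n. if n = 0 then 0 ^ k else 0)) (at_top :: real filter)"
  proof (rule tannerys_theorem[THEN conjunct2, THEN conjunct2])
    fix n :: nat
    have "((\<lambda>x::real. exp (- x)) \<longlongrightarrow> 0) at_top" by real_asymp
    from tendsto_of_real[OF this, where 'a = complex]
    have "((\<lambda>x. exp (- complex_of_real x)) \<longlongrightarrow> 0) at_top" by (simp flip: exp_of_real of_real_minus)
    hence "((\<lambda>x. of_nat n ^ k * hyp_coeff a b c n * (- exp (- complex_of_real x)) ^ n) \<longlongrightarrow> of_nat n ^ k * hyp_coeff a b c n * (- 0) ^ n) at_top"
      by (intro tendsto_intros)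
    thus "((\<lambda>x. of_nat n ^ k * hyp_coeff a b c n * (- exp (- complex_of_real x)) ^ n) \<longlongrightarrow> (if n = 0 then 0 ^ k else 0)) at_top"
      by (cases n) auto
  next
    have "eventually (\<lambda>x::real. x \<ge> 0) at_top" by (rule eventually_ge_at_top)
    from eventually_prodI[OF always_eventually[of "\<lambda>_::nat. True"] this, of sequentially]
    show "\<forall>\<^sub>F (n, x) in sequentially \<times>\<^sub>F at_top. norm (of_nat n ^ k * hyp_coeff a b c n * (- exp (- complex_of_real x)) ^ n) \<le> M n"
      by (rule eventually_mono) (use M(2)[OF k] in auto)
  qed (use M in auto)
  also have "(\<Sum>n. if n = (0::nat) then 0 ^ k else 0) = (0 ^ k :: complex)"
    using sums_single[of 0 "\<lambda>_. 0 ^ k :: complex"] by (simp add: sums_iff)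
  finally show ?thesis by (simp add: hyp_deriv_def)
qed

text \<open>The constant is read off as z tends to infinity along the reals: the solutions behave
  like exp (- a z) and exp (- b z), their Wronskian like (a - b) exp (- (a + b) z), and the
  integrating factor like exp ((a + b) z).\<close>

lemma wronskian_hyp_inf:
  assumes ab: "a - b \<notin> \<int>" and pos: "Re (c - a - b) > 3" and z: "Re z \<ge> 0" "\<bar>Im z\<bar> < pi"
  shows "(hyp_inf a b c z * hyp_inf' b a c z - hyp_inf' a b c z * hyp_inf b a c z) *
           (exp ((c - 1) * z) * (1 + exp z) powr (a + b + 1 - c)) = a - b"
proof -
  have ba: "b - a \<notin> \<int>" using minus_notin_Ints_commute[OF ab] .
  define S where "S = {z. Re z \<ge> 0} \<inter> {z. \<bar>Im z\<bar> < pi}"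
  have "S = {z. Re z \<ge> 0} \<inter> ({z. Im z < pi} \<inter> {z. Im z > - pi})" by (auto simp: S_def abs_less_iff)
  hence convex: "convex S"
    by (simp only:) (intro convex_Int convex_halfspace_Re_ge convex_halfspace_Im_lt convex_halfspace_Im_gt)
  let ?W = "\<lambda>z. (hyp_inf a b c z * hyp_inf' b a c z - hyp_inf' a b c z * hyp_inf b a c z) *
           (exp ((c - 1) * z) * (1 + exp z) powr (a + b + 1 - c))"
  have "hyp_ode_on a b c S (hyp_inf a b c) (hyp_inf' a b c)"
    by (rule hyp_ode_on_subset[OF hyp_ode_on_right[OF ab pos]]) (auto simp: S_def)
  moreover have "hyp_ode_on a b c S (hyp_inf b a c) (hyp_inf' b a c)"
    by (subst hyp_ode_on_commute, rule hyp_ode_on_subset[OF hyp_ode_on_right[OF ba]]) (use pos in \<open>auto simp: S_def\<close>)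
  ultimately have "\<exists>K. \<forall>z\<in>S. ?W z = K"
    by (rule wronskian_constant[OF _ _ convex]) (auto simp: S_def)
  then obtain K where K: "\<And>z. z \<in> S \<Longrightarrow> ?W z = K" by blast
  define U where "U = (\<lambda>k x. hyp_deriv a (a - c + 1) (a - b + 1) k (- of_real x))"
  define V where "V = (\<lambda>k x. hyp_deriv b (b - c + 1) (b - a + 1) k (- of_real x))"
  have U: "(U 0 \<longlongrightarrow> 1) at_top" "(U 1 \<longlongrightarrow> 0) at_top"
    using hyp_deriv_at_minus_infinity[OF nonint_diff[OF ab], of a "a - c + 1" 0]
          hyp_deriv_at_minus_infinity[OF nonint_diff[OF ab], of a "a - c + 1" 1] pos by (auto simp: U_def)
  have V: "(V 0 \<longlongrightarrow> 1) at_top" "(V 1 \<longlongrightarrow> 0) at_top"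
    using hyp_deriv_at_minus_infinity[OF nonint_diff[OF ba], of b "b - c + 1" 0]
          hyp_deriv_at_minus_infinity[OF nonint_diff[OF ba], of b "b - c + 1" 1] pos by (auto simp: V_def)
  \<comment> \<open>All exponentials are collected into one whose exponent is a multiple of ln (1 +
    exp x) - x, which tends to 0.\<close>
  have "?W (of_real x) = ((a * U 0 x + U 1 x) * V 0 x - U 0 x * (b * V 0 x + V 1 x)) *
           exp ((a + b + 1 - c) * of_real (ln (1 + exp x) - x))" for x :: real
  proof -
    have "(1 + exp (of_real x)) powr (a + b + 1 - c) = exp ((a + b + 1 - c) * of_real (ln (1 + exp x)))"
    proof -
      have p: "1 + exp x > 0" by (simp add: add_pos_pos)
      have "1 + exp (of_real x) = complex_of_real (1 + exp x)" by (simp add: exp_of_real)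
      thus ?thesis using p by (simp only: powr_def Ln_of_real[OF p] of_real_eq_0_iff) simp
    qed
    moreover have "exp (- a * of_real x) * exp (- b * of_real x) * exp ((c - 1) * of_real x) =
       exp (- ((a + b + 1 - c) * complex_of_real x))"
      unfolding exp_add[symmetric] by (simp add: algebra_simps)
    moreover have "exp ((a + b + 1 - c) * of_real (ln (1 + exp x) - x)) =
       exp (- ((a + b + 1 - c) * complex_of_real x)) * exp ((a + b + 1 - c) * of_real (ln (1 + exp x)))"
      unfolding exp_add[symmetric] by (simp add: algebra_simps)
    moreover have "(ea * u0 * - (eb * (b * v0 + v1)) - - (ea * (a * u0 + u1)) * (eb * v0)) * (ec * P) = ((a * u0 + u1) * v0 - u0 * (b * v0 + v1)) * ((ea * eb * ec) * P)"
      for ea u0 eb v0 v1 u1 ec P by (simp add: algebra_simps)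
    ultimately show ?thesis by (simp only: hyp_inf_def hyp_inf'_def U_def V_def mult_minus_left)
  qed
  moreover have "((\<lambda>x. ((a * U 0 x + U 1 x) * V 0 x - U 0 x * (b * V 0 x + V 1 x)) *
           exp ((a + b + 1 - c) * of_real (ln (1 + exp x) - x))) \<longlongrightarrow>
         ((a * 1 + 0) * 1 - 1 * (b * 1 + 0)) * exp ((a + b + 1 - c) * of_real 0)) at_top"
  proof (intro tendsto_intros U V)
    show "((\<lambda>x::real. ln (1 + exp x) - x) \<longlongrightarrow> 0) at_top" by real_asymp
  qed
  ultimately have "((\<lambda>x. ?W (of_real x)) \<longlongrightarrow> a - b) at_top" by simp
  moreover have "eventually (\<lambda>x. ?W (of_real x) = K) at_top"
    using eventually_ge_at_top[of 0] by eventually_elim (rule K, simp add: S_def)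
  ultimately have "((\<lambda>x. K) \<longlongrightarrow> a - b) (at_top :: real filter)"
    by (rule Lim_transform_eventually)
  hence "K = a - b" by (simp add: tendsto_const_iff)
  moreover have "z \<in> S" using z by (simp add: S_def)
  ultimately show ?thesis using K by blast
qed

lemma hyp_series_commute: "hyp_series a b c w = hyp_series b a c w"
  unfolding hyp_series_def by (simp add: hyp_coeff_commute)

lemma hyp_inf_altdef:
  "hyp_inf a b c \<zeta> = exp (- a * \<zeta>) * hyp_series a (a - c + 1) (a - b + 1) (- exp (- \<zeta>))"
  by (simp add: hyp_inf_def hyp_deriv_0)

lemma hyp_ode_on_imp_continuous_on: "hyp_ode_on a b c S u u' \<Longrightarrow> continuous_on S u"
  unfolding hyp_ode_on_def by (meson DERIV_continuous_on)

text \<open>With three solutions, expanding a \<open>3 \<times> 3\<close> determinant with two equal rows expresses one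
  of them through the others and the (essentially constant) Wronskians.\<close>
lemma hyp_arc_combination:
  assumes c: "c \<notin> \<int>\<^sub>\<le>\<^sub>0" and ab: "a - b \<notin> \<int>" and pos: "Re (c - a - b) > 3"
  obtains \<alpha> \<beta> where "\<And>t. t \<in> {-pi..pi} \<Longrightarrow> hyp_series a b c (- exp (\<i> * of_real t)) =
      \<alpha> * hyp_inf a b c (\<i> * of_real t) + \<beta> * hyp_inf b a c (\<i> * of_real t)"
proof -
  have ba: "b - a \<notin> \<int>" using minus_notin_Ints_commute[OF ab] .
  define T where "T = {z. Re z = 0} \<inter> {z. \<bar>Im z\<bar> < pi}"
  have "T = {z. Re z \<le> 0} \<inter> ({z. Re z \<ge> 0} \<inter> ({z. Im z < pi} \<inter> {z. Im z > - pi}))"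
    by (auto simp: T_def abs_less_iff)
  hence convex: "convex T"
    by (simp only:) (intro convex_Int convex_halfspace_Re_ge convex_halfspace_Re_le convex_halfspace_Im_lt convex_halfspace_Im_gt)
  let ?f = "hyp_deriv a b c 0" and ?f' = "hyp_deriv a b c 1"
  let ?u = "hyp_inf a b c" and ?u' = "hyp_inf' a b c"
  let ?v = "hyp_inf b a c" and ?v' = "hyp_inf' b a c"
  let ?E = "\<lambda>z. exp ((c - 1) * z) * (1 + exp z) powr (a + b + 1 - c)"
  have pos': "Re (c - b - a) > 3" using pos by simp
  have f0: "hyp_ode_on a b c {z. Re z \<le> 0} ?f ?f'" by (rule hyp_ode_on_left[OF c pos])
  have u0: "hyp_ode_on a b c {z. Re z \<ge> 0} ?u ?u'" by (rule hyp_ode_on_right[OF ab pos])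
  have v0: "hyp_ode_on a b c {z. Re z \<ge> 0} ?v ?v'" 
    by (subst hyp_ode_on_commute) (rule hyp_ode_on_right[OF ba pos'])
  have f: "hyp_ode_on a b c T ?f ?f'" by (rule hyp_ode_on_subset[OF f0]) (auto simp: T_def)
  have u: "hyp_ode_on a b c T ?u ?u'" by (rule hyp_ode_on_subset[OF u0]) (auto simp: T_def)
  have v: "hyp_ode_on a b c T ?v ?v'" by (rule hyp_ode_on_subset[OF v0]) (auto simp: T_def)
  have "\<exists>K. \<forall>z\<in>T. (?f z * ?u' z - ?f' z * ?u z) * ?E z = K"
    by (rule wronskian_constant[OF f u convex]) (auto simp: T_def)
  then obtain K1 where K1: "\<And>z. z \<in> T \<Longrightarrow> (?f z * ?u' z - ?f' z * ?u z) * ?E z = K1" by blast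
  have "\<exists>K. \<forall>z\<in>T. (?f z * ?v' z - ?f' z * ?v z) * ?E z = K"
    by (rule wronskian_constant[OF f v convex]) (auto simp: T_def)
  then obtain K2 where K2: "\<And>z. z \<in> T \<Longrightarrow> (?f z * ?v' z - ?f' z * ?v z) * ?E z = K2" by blast
  have K: "(?u z * ?v' z - ?u' z * ?v z) * ?E z = a - b" if "z \<in> T" for z
    by (rule wronskian_hyp_inf[OF ab pos]) (use that in \<open>auto simp: T_def\<close>)
  have nz: "a - b \<noteq> 0" using ab by force
  have eq: "?f z = K2 / (a - b) * ?u z + (- K1 / (a - b)) * ?v z" if z: "z \<in> T" for z
  proof -
    have "f * ((u * v' - u' * v) * E) = u * ((f * v' - f' * v) * E) - v * ((f * u' - f' * u) * E)"
      for f f' u u' v v' E :: complex by (simp add: algebra_simps)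
    from this[of "?f z" "?u z" "?v' z" "?u' z" "?v z" "?E z" "?f' z"]
    have "?f z * (a - b) = ?u z * K2 - ?v z * K1"
      unfolding K[OF z] K1[OF z] K2[OF z] .
    moreover have "f = k2 / d * u + (- k1 / d) * v" if "f * d = u * k2 - v * k1" "d \<noteq> 0"
      for f u v k1 k2 d :: complex using that by (simp add: field_simps)
    ultimately show ?thesis using nz by blast
  qed
  \<comment> \<open>At t = pi and t = -pi the leading coefficient 1 + exp z vanishes, so the
    Wronskians say nothing there; continuity of all three solutions carries the identity to these
    endpoints.\<close>
  define D where "D = (\<lambda>t. ?f (\<i> * of_real t) - (K2 / (a - b) * ?u (\<i> * of_real t) + (- K1 / (a - b)) * ?v (\<i> * of_real t)))"
  have "continuous_on UNIV D"
    unfolding D_def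
    by (intro continuous_intros
          continuous_on_compose2[OF hyp_ode_on_imp_continuous_on[OF f0]]
          continuous_on_compose2[OF hyp_ode_on_imp_continuous_on[OF u0]]
          continuous_on_compose2[OF hyp_ode_on_imp_continuous_on[OF v0]]) auto
  hence cont: "continuous_on (closure {-pi<..<pi}) D" using continuous_on_subset by blast
  have "D t = 0" if "t \<in> closure {-pi<..<pi}" for t
    by (rule continuous_constant_on_closure[OF cont _ that]) (auto simp: D_def eq T_def)
  hence "D t = 0" if "t \<in> {-pi..pi}" for t using that by simp
  thus ?thesis using that[of "K2 / (a - b)" "- K1 / (a - b)"]
    by (simp add: D_def hyp_deriv_0)
qed

text \<open>The reciprocal Gamma factors are written with the entire function \<open>rGamma\<close>,
  so that continuity in the parameters includes the zeros.\<close>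

definition conn :: "complex \<Rightarrow> complex \<Rightarrow> complex \<Rightarrow> complex" where
  "conn a b c = Gamma c * Gamma (b - a) * rGamma b * rGamma (c - a)"

definition hyp_right :: "complex \<Rightarrow> complex \<Rightarrow> complex \<Rightarrow> complex \<Rightarrow> complex" where
  "hyp_right a b c \<zeta> = conn a b c * hyp_inf a b c \<zeta> + conn b a c * hyp_inf b a c \<zeta>"

lemma Gamma_mult_rGamma: "z \<notin> \<int>\<^sub>\<le>\<^sub>0 \<Longrightarrow> Gamma z * rGamma z = (1::complex)"
  by (simp add: Gamma_def rGamma_eq_zero_iff)

text \<open>Both endpoints of the arc are w = 1, where f takes a single value while the solutions at
  infinity differ by phases. Eliminating one of them leaves hyp_series a b c 1 * sin (pi b) =
  \<alpha> * U * sin (pi (b - a)); reflection turns the sines into Gamma factors and Gauss' theorem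
  evaluates both series. \<open>U\<close> can vanish, so it is cancelled only under the extra
  condition.\<close>

lemma conn_at_1:
  assumes c: "c \<notin> \<int>\<^sub>\<le>\<^sub>0" and ab: "a - b \<notin> \<int>" and pos: "Re (c - a - b) > 3"
  defines "U \<equiv> hyp_series a (a - c + 1) (a - b + 1) 1"
  assumes e1: "hyp_series a b c 1 = \<alpha> * (exp (- a * (\<i> * pi)) * U) + \<beta> * (exp (- b * (\<i> * pi)) * V)"
  assumes e2: "hyp_series a b c 1 = \<alpha> * (exp (a * (\<i> * pi)) * U) + \<beta> * (exp (b * (\<i> * pi)) * V)"
  shows "\<alpha> * U = conn a b c * U" "rGamma (1 - b) * rGamma (c - b) \<noteq> 0 \<Longrightarrow> U \<noteq> 0"
proof -
  define x y where "x = exp (a * (\<i> * pi))" and "y = exp (b * (\<i> * pi))"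
  define \<Phi> where "\<Phi> = hyp_series a b c 1"
  define s where "s = c - a - b"
  have ba: "b - a \<notin> \<int>" using minus_notin_Ints_commute[OF ab] .
  have ba': "b - a \<notin> \<int>\<^sub>\<le>\<^sub>0" "1 - (b - a) \<notin> \<int>\<^sub>\<le>\<^sub>0"
    using ba nonint_diff[OF ab] nonpos_Ints_Int by (auto simp: algebra_simps)
  have s: "rGamma s \<noteq> 0"
    unfolding rGamma_eq_zero_iff s_def using pos by (auto elim!: nonpos_Ints_cases simp: complex_eq_iff)
  have xy: "x \<noteq> 0" "y \<noteq> 0" "exp (- a * (\<i> * pi)) = 1 / x" "exp (- b * (\<i> * pi)) = 1 / y"
    by (auto simp: x_def y_def exp_minus field_simps)
  \<comment> \<open>y times \<open>e1\<close> minus 1 / y times \<open>e2\<close> eliminates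
    \<open>V\<close>.\<close>
  have "\<Phi> * (y - 1 / y) = y * \<Phi> - 1 / y * \<Phi>" by (simp add: algebra_simps)
  also have "\<dots> = y * (\<alpha> * (1 / x * U) + \<beta> * (1 / y * V)) - 1 / y * (\<alpha> * (x * U) + \<beta> * (y * V))"
    using e1 e2 unfolding xy(3,4) x_def[symmetric] y_def[symmetric] \<Phi>_def by simp
  also have "\<dots> = \<alpha> * U * (y / x - x / y)" using xy(1,2) by (simp add: field_simps)
  finally have "\<Phi> * ((y - 1 / y) / (2 * \<i>)) = \<alpha> * U * ((y / x - x / y) / (2 * \<i>))" by simp
  also have "(y - 1 / y) / (2 * \<i>) = sin (of_real pi * b)"
    by (simp add: sin_exp_eq y_def exp_minus field_simps)
  also have "(y / x - x / y) / (2 * \<i>) = sin (of_real pi * (b - a))"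
    unfolding x_def y_def exp_diff[symmetric] by (simp add: sin_exp_eq algebra_simps)
  finally have "\<Phi> * (sin (of_real pi * b) / of_real pi) = \<alpha> * U * (sin (of_real pi * (b - a)) / of_real pi)"
    by simp
  hence 1: "\<Phi> * (rGamma b * rGamma (1 - b)) = \<alpha> * U * (rGamma (b - a) * rGamma (1 - (b - a)))"
    unfolding rGamma_reflection_complex .
  have G1: "\<Phi> * rGamma c * rGamma s = rGamma (c - a) * rGamma (c - b)"
    unfolding \<Phi>_def s_def by (rule gauss_summation[OF c]) (use pos in auto)
  have "U * rGamma (a - b + 1) * rGamma (a - b + 1 - a - (a - c + 1)) = rGamma (a - b + 1 - a) * rGamma (a - b + 1 - (a - c + 1))"
    unfolding U_def by (rule gauss_summation[OF nonint_diff[OF ab]]) (use pos in auto)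
  hence G2: "U * rGamma (1 - (b - a)) * rGamma s = rGamma (1 - b) * rGamma (c - b)"
    by (simp add: s_def algebra_simps)
  have Gc: "Gamma c * rGamma c = 1" by (rule Gamma_mult_rGamma[OF c])
  have Gba: "Gamma (b - a) * rGamma (b - a) = 1" by (rule Gamma_mult_rGamma[OF ba'(1)])
  have "conn a b c * U * (rGamma (b - a) * rGamma (1 - (b - a))) * rGamma s =
         Gamma c * rGamma b * rGamma (c - a) * (Gamma (b - a) * rGamma (b - a)) * (U * rGamma (1 - (b - a)) * rGamma s)"
    unfolding conn_def by (simp only: mult_ac)
  also have "\<dots> = Gamma c * rGamma b * rGamma (1 - b) * (rGamma (c - a) * rGamma (c - b))"
    unfolding Gba G2 by (simp add: mult_ac)
  also have "\<dots> = (Gamma c * rGamma c) * (\<Phi> * (rGamma b * rGamma (1 - b))) * rGamma s"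
    unfolding G1[symmetric] by (simp only: mult_ac)
  also have "\<dots> = \<alpha> * U * (rGamma (b - a) * rGamma (1 - (b - a))) * rGamma s"
    unfolding Gc 1 by simp
  finally show "\<alpha> * U = conn a b c * U"
    using s ba' by (auto simp: rGamma_eq_zero_iff)
  show "U \<noteq> 0" if "rGamma (1 - b) * rGamma (c - b) \<noteq> 0"
    using G2 that by auto
qed

text \<open>The conditions \<open>gen\<close> make both Gauss values at 1 of the solutions at
  infinity nonzero, so both coefficients are determined; the second one follows from the first by
  exchanging a and b.\<close>

lemma hyp_arc_generic:
  assumes c: "c \<notin> \<int>\<^sub>\<le>\<^sub>0" and ab: "a - b \<notin> \<int>" and pos: "Re (c - a - b) > 3"
    and gen: "rGamma (1 - b) * rGamma (c - b) \<noteq> 0" "rGamma (1 - a) * rGamma (c - a) \<noteq> 0"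
    and t: "t \<in> {-pi..pi}"
  shows "hyp_series a b c (- exp (\<i> * of_real t)) = hyp_right a b c (\<i> * of_real t)"
proof -
  have ba: "b - a \<notin> \<int>" using minus_notin_Ints_commute[OF ab] .
  obtain \<alpha> \<beta> where *: "\<And>t. t \<in> {-pi..pi} \<Longrightarrow> hyp_series a b c (- exp (\<i> * of_real t)) =
      \<alpha> * hyp_inf a b c (\<i> * of_real t) + \<beta> * hyp_inf b a c (\<i> * of_real t)"
    by (rule hyp_arc_combination[OF c ab pos]) (rule that)
  define U V where "U = hyp_series a (a - c + 1) (a - b + 1) 1" and "V = hyp_series b (b - c + 1) (b - a + 1) 1"
  have e: "exp (\<i> * of_real pi) = -1" "exp (- (\<i> * of_real pi)) = -1"
    by (simp_all add: exp_minus exp_pi_i')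
  have e1: "hyp_series a b c 1 = \<alpha> * (exp (- a * (\<i> * pi)) * U) + \<beta> * (exp (- b * (\<i> * pi)) * V)"
    using *[of pi] by (simp add: hyp_inf_altdef U_def V_def e)
  have e2: "hyp_series a b c 1 = \<alpha> * (exp (a * (\<i> * pi)) * U) + \<beta> * (exp (b * (\<i> * pi)) * V)"
    using *[of "- pi"] by (simp add: hyp_inf_altdef U_def V_def e)
  have "\<alpha> = conn a b c"
    using conn_at_1[OF c ab pos e1[unfolded U_def] e2[unfolded U_def]] gen by auto
  moreover have "\<beta> = conn b a c"
  proof -
    have pos': "Re (c - b - a) > 3" using pos by simp
    have e1': "hyp_series b a c 1 = \<beta> * (exp (- b * (\<i> * pi)) * V) + \<alpha> * (exp (- a * (\<i> * pi)) * U)"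
      using e1 hyp_series_commute by (metis add.commute)
    have e2': "hyp_series b a c 1 = \<beta> * (exp (b * (\<i> * pi)) * V) + \<alpha> * (exp (a * (\<i> * pi)) * U)"
      using e2 hyp_series_commute by (metis add.commute)
    show ?thesis using conn_at_1[OF c ba pos' e1'[unfolded V_def] e2'[unfolded V_def]] gen by auto
  qed
  ultimately show ?thesis using *[OF t] by (simp add: hyp_right_def)
qed

section \<open>Removal of the nonvanishing conditions on the arc\<close>

lemma eventually_not_int:
  "eventually (\<lambda>t. d - t \<notin> \<int>) (at (0::complex))"
proof (cases "d \<in> \<int>")
  case True
  have "eventually (\<lambda>t::complex. t \<in> ball 0 1 - {0}) (at 0)"
    by (intro eventually_at_in_open) auto
  thus ?thesis
  proof eventually_elim
    case (elim t)
    show ?case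
    proof
      assume "d - t \<in> \<int>"
      hence "t \<in> \<int>" using True by (metis Ints_diff diff_diff_eq2 add_diff_cancel_left')
      then obtain n where n: "t = of_int n" by (elim Ints_cases)
      hence "\<bar>of_int n\<bar> < (1::real)" using elim by simp
      hence "n = 0" by linarith
      thus False using n elim by simp
    qed
  qed
next
  case False
  have "((\<lambda>t. d - t) \<longlongrightarrow> d - 0) (at 0)" by (intro tendsto_intros)
  from topological_tendstoD[OF this, of "- \<int>"] show ?thesis
    using False by (auto simp: open_Compl)
qed

lemma eventually_rGamma_neq_0: "eventually (\<lambda>t. rGamma (d - t) \<noteq> 0) (at (0::complex))"
  using eventually_not_int[of d] by eventually_elim (auto simp: rGamma_eq_zero_iff)

lemma tendsto_rGamma: "(f \<longlongrightarrow> z) F \<Longrightarrow> ((\<lambda>x. rGamma (f x)) \<longlongrightarrow> rGamma (z :: complex)) F"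
  by (rule continuous_on_tendsto_compose[OF continuous_on_rGamma[of UNIV]]) auto

text \<open>The shift (a + s, b + s) keeps a - b off the integers and, for small s, the excess above
  3, while the nonvanishing conditions hold for all small nonzero s. Both sides are continuous at s
  = 0.\<close>

lemma hyp_arc:
  assumes c: "c \<notin> \<int>\<^sub>\<le>\<^sub>0" and ab: "a - b \<notin> \<int>" and pos: "Re (c - a - b) > 3"
    and t: "t \<in> {-pi..pi}"
  shows "hyp_series a b c (- exp (\<i> * of_real t)) = hyp_right a b c (\<i> * of_real t)"
proof -
  have ba: "b - a \<notin> \<int>" using minus_notin_Ints_commute[OF ab] .
  define z where "z = \<i> * complex_of_real t"
  have nz: "norm (- exp z) = 1" "norm (- exp (- z)) = 1" by (simp_all add: z_def)
  have "((\<lambda>s. Re (c - (a + s) - (b + s))) \<longlongrightarrow> Re (c - (a + 0) - (b + 0))) (at 0)"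
    by (intro tendsto_intros)
  from order_tendstoD(1)[OF this, of 3] have "eventually (\<lambda>s. Re (c - (a + s) - (b + s)) > 3) (at 0)"
    using pos by simp
  with eventually_rGamma_neq_0[of "1 - b"] eventually_rGamma_neq_0[of "c - b"]
    eventually_rGamma_neq_0[of "1 - a"] eventually_rGamma_neq_0[of "c - a"]
  have ev: "eventually (\<lambda>s. hyp_series (a + s) (b + s) c (- exp z) = hyp_right (a + s) (b + s) c z) (at 0)"
    unfolding z_def
  proof eventually_elim
    case (elim s)
    show ?case by (rule hyp_arc_generic[OF c _ _ _ _ t]) (use elim ab in \<open>auto simp: algebra_simps\<close>)
  qed
  have l1: "((\<lambda>s. hyp_series (a + s) (b + s) c (- exp z)) \<longlongrightarrow> hyp_series (a + 0) (b + 0) c (- exp z)) (at 0)"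
  proof (intro hyp_series_tendsto tendsto_intros)
  qed (use c pos nz in auto)
  have l2: "((\<lambda>s. conn (a + s) (b + s) c * hyp_inf (a + s) (b + s) c z) \<longlongrightarrow>
               conn (a + 0) (b + 0) c * hyp_inf (a + 0) (b + 0) c z) (at 0)"
    if "a - b \<notin> \<int>" "Re (c - a - b) > 3" for a b
    unfolding conn_def hyp_inf_altdef
  proof (intro tendsto_intros tendsto_rGamma hyp_series_tendsto)
    show "a + 0 - (b + 0) + 1 \<notin> \<int>\<^sub>\<le>\<^sub>0" using nonint_diff[OF that(1)] by simp
    show "b + 0 - (a + 0) \<notin> \<int>\<^sub>\<le>\<^sub>0" using that by (metis Ints_minus add_0_right minus_diff_eq nonpos_Ints_Int)
  qed (use that nz in auto)
  have "((\<lambda>s. hyp_right (a + s) (b + s) c z) \<longlongrightarrow> hyp_right (a + 0) (b + 0) c z) (at 0)"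
    unfolding hyp_right_def by (intro tendsto_add l2) (use ab ba pos in auto)
  hence "((\<lambda>s. hyp_series (a + s) (b + s) c (- exp z)) \<longlongrightarrow> hyp_right (a + 0) (b + 0) c z) (at 0)"
    by (rule Lim_transform_eventually) (use ev in eventually_elim, simp)
  from tendsto_unique[OF _ l1 this] show ?thesis by (simp add: z_def)
qed

subsection \<open>Continuation to the slit plane\<close>

abbreviation slit_plane :: "complex set" where
  "slit_plane \<equiv> - complex_of_real ` {1..}"

text \<open>Two overlapping charts: the disc, where the series lives, and the plane without [0,
  infinity), where \<zeta> = Ln (- w) is holomorphic.\<close>

lemma slit_plane_iff: "w \<in> slit_plane \<longleftrightarrow> norm w < 1 \<or> - w \<notin> \<real>\<^sub>\<le>\<^sub>0"
proof (cases "w \<in> \<real>")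
  case True
  then obtain x where "w = of_real x" by (elim Reals_cases)
  thus ?thesis by (auto simp: image_iff complex_nonpos_Reals_iff)
next
  case False
  hence "Im w \<noteq> 0" by (simp add: complex_is_Real_iff)
  hence "w \<in> slit_plane" "- w \<notin> \<real>\<^sub>\<le>\<^sub>0" by (auto simp: complex_nonpos_Reals_iff)
  thus ?thesis by simp
qed

lemma slit_plane_eq: "slit_plane = ball 0 1 \<union> {w. - w \<notin> \<real>\<^sub>\<le>\<^sub>0}"
  using slit_plane_iff by auto

lemma open_minus_notin_nonpos_Reals: "open {w :: complex. - w \<notin> \<real>\<^sub>\<le>\<^sub>0}"
proof -
  have "open (uminus -` (- \<real>\<^sub>\<le>\<^sub>0) :: complex set)"
    by (intro open_vimage open_Compl closed_nonpos_Reals_complex continuous_intros)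
  thus ?thesis by (simp add: vimage_def)
qed

lemma open_slit_plane: "open slit_plane"
  unfolding slit_plane_eq by (intro open_Un open_minus_notin_nonpos_Reals) auto

lemma exp_slit_plane:
  assumes "\<bar>Im \<zeta>\<bar> < pi"
  shows "- exp \<zeta> \<in> slit_plane"
proof -
  have "exp \<zeta> \<notin> \<real>\<^sub>\<le>\<^sub>0"
  proof
    assume "exp \<zeta> \<in> \<real>\<^sub>\<le>\<^sub>0"
    hence *: "exp (Re \<zeta>) * cos (Im \<zeta>) \<le> 0" "sin (Im \<zeta>) = 0"
      by (auto simp: complex_nonpos_Reals_iff Re_exp Im_exp)
    have "Im \<zeta> = 0" using *(2) assms by (metis abs_less_iff minus_less_iff sin_eq_0_pi)
    thus False using *(1) by simp
  qed
  thus ?thesis unfolding slit_plane_iff by simp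
qed

lemma abs_Im_Ln_less_pi: "z \<notin> \<real>\<^sub>\<le>\<^sub>0 \<Longrightarrow> \<bar>Im (Ln z)\<bar> < pi"
  using Im_Ln_less_pi[of z] mpi_less_Im_Ln[of z] by (cases "z = 0") (auto simp: abs_less_iff)

section \<open>Regularity of the two local expressions\<close>

lemma continuous_on_hyp_series:
  assumes "continuous_on X \<alpha>" "continuous_on X \<beta>" "continuous_on X \<gamma>" "continuous_on X z"
    and "\<And>x. x \<in> X \<Longrightarrow> \<gamma> x \<notin> \<int>\<^sub>\<le>\<^sub>0"
    and "\<And>x. x \<in> X \<Longrightarrow> norm (z x) \<le> 1"
    and "\<And>x. x \<in> X \<Longrightarrow> norm (z x) < 1 \<or> Re (\<gamma> x - \<alpha> x - \<beta> x) > 0"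
  shows "continuous_on X (\<lambda>x. hyp_series (\<alpha> x) (\<beta> x) (\<gamma> x) (z x))"
  unfolding continuous_on_def
proof
  fix x assume x: "x \<in> X"
  have "eventually (\<lambda>y. y \<in> X) (at x within X)"
    by (simp add: eventually_at_filter)
  hence "eventually (\<lambda>y. norm (z y) \<le> 1) (at x within X)"
    by eventually_elim (use assms(6) in auto)
  thus "((\<lambda>x. hyp_series (\<alpha> x) (\<beta> x) (\<gamma> x) (z x)) \<longlongrightarrow> hyp_series (\<alpha> x) (\<beta> x) (\<gamma> x) (z x)) (at x within X)"
    by (intro hyp_series_tendsto) (use assms x in \<open>auto simp: continuous_on_def\<close>)
qed

lemma continuous_on_hyp_right:
  assumes "continuous_on X \<alpha>" "continuous_on X \<beta>" "continuous_on X \<zeta>"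
    and "\<And>x. x \<in> X \<Longrightarrow> \<alpha> x - \<beta> x \<notin> \<int>"
    and "\<And>x. x \<in> X \<Longrightarrow> Re (\<zeta> x) \<ge> 0"
    and "\<And>x. x \<in> X \<Longrightarrow> Re (\<zeta> x) > 0 \<or> Re (c - \<alpha> x - \<beta> x) > 0"
  shows "continuous_on X (\<lambda>x. hyp_right (\<alpha> x) (\<beta> x) c (\<zeta> x))"
proof -
  have *: "continuous_on X (\<lambda>x. conn (\<alpha> x) (\<beta> x) c * hyp_inf (\<alpha> x) (\<beta> x) c (\<zeta> x))"
    if "continuous_on X \<alpha>" "continuous_on X \<beta>" "\<And>x. x \<in> X \<Longrightarrow> \<alpha> x - \<beta> x \<notin> \<int>"
    and pos: "\<And>x. x \<in> X \<Longrightarrow> Re (\<zeta> x) > 0 \<or> Re (c - \<alpha> x - \<beta> x) > 0" for \<alpha> \<beta>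
  proof -
    have "\<beta> x - \<alpha> x \<notin> \<int>\<^sub>\<le>\<^sub>0" if "x \<in> X" for x
      using that(1) \<open>\<And>x. x \<in> X \<Longrightarrow> \<alpha> x - \<beta> x \<notin> \<int>\<close> by (metis Ints_minus minus_diff_eq nonpos_Ints_Int)
    thus ?thesis unfolding conn_def hyp_inf_altdef
      by (intro continuous_intros continuous_on_Gamma continuous_on_hyp_series
            continuous_on_compose2[OF continuous_on_rGamma[of UNIV]]
            continuous_on_compose2[OF continuous_on_Gamma[of "- \<int>\<^sub>\<le>\<^sub>0"]])
         (use that assms(3,5) nonint_diff in auto)
  qed
  have "\<beta> x - \<alpha> x \<notin> \<int>" if "x \<in> X" for x
    using assms(4)[OF that] by (metis Ints_minus minus_diff_eq)
  moreover have "Re (\<zeta> x) > 0 \<or> Re (c - \<beta> x - \<alpha> x) > 0" if "x \<in> X" for x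
    using assms(6)[OF that] by auto
  ultimately show ?thesis unfolding hyp_right_def
    by (intro continuous_on_add * assms) auto
qed

lemma holomorphic_hyp_series:
  assumes "c \<notin> \<int>\<^sub>\<le>\<^sub>0"
  shows "hyp_series a b c holomorphic_on ball 0 1"
  by (rule power_series_holomorphic[where a = "hyp_coeff a b c"])
     (use hyp_series_sums[OF assms] in auto)

lemma holomorphic_hyp_right:
  assumes "a - b \<notin> \<int>"
  shows "hyp_right a b c holomorphic_on {z. Re z > 0}"
proof -
  have *: "hyp_inf a b c holomorphic_on {z. Re z > 0}" if "a - b \<notin> \<int>" for a b
  proof -
    have "(hyp_series a (a - c + 1) (a - b + 1) \<circ> (\<lambda>z. - exp (- z))) holomorphic_on {z. Re z > 0}"
      by (rule holomorphic_on_compose_gen[OF _ holomorphic_hyp_series[OF nonint_diff[OF that]]])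
         (auto intro!: holomorphic_intros)
    hence "(\<lambda>z. exp (- a * z) * hyp_series a (a - c + 1) (a - b + 1) (- exp (- z))) holomorphic_on {z. Re z > 0}"
      by (intro holomorphic_intros) (simp_all add: o_def)
    thus ?thesis by (simp add: hyp_inf_altdef[abs_def])
  qed
  have "b - a \<notin> \<int>" using assms by (metis Ints_minus minus_diff_eq)
  thus ?thesis unfolding hyp_right_def[abs_def] by (intro holomorphic_intros * assms)
qed

text \<open>One \<open>H\<close> for all (a, b) at once, jointly continuous, because it will be
  integrated over circles of parameters. The bound \<open>B\<close> makes finitely many shifts of c
  sufficient for all these (a, b) together.\<close>

definition hyp_continuation :: "complex \<Rightarrow> real \<Rightarrow> (complex \<Rightarrow> complex \<Rightarrow> complex \<Rightarrow> complex) \<Rightarrow> bool" where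
  "hyp_continuation c B H \<longleftrightarrow>
     continuous_on {(a, b, w). a - b \<notin> \<int> \<and> norm a < B \<and> norm b < B \<and> w \<in> slit_plane} (\<lambda>(a, b, w). H a b w) \<and>
     (\<forall>a b. a - b \<notin> \<int> \<longrightarrow> norm a < B \<longrightarrow> norm b < B \<longrightarrow>
        H a b holomorphic_on slit_plane \<and>
        (\<forall>w\<in>ball 0 1. H a b w = hyp_series a b c w) \<and>
        (\<forall>\<zeta>. Re \<zeta> > 0 \<longrightarrow> \<bar>Im \<zeta>\<bar> < pi \<longrightarrow> H a b (- exp \<zeta>) = hyp_right a b c \<zeta>))"

lemma Ln_minus_exp: "\<bar>Im \<zeta>\<bar> < pi \<Longrightarrow> Ln (- (- exp \<zeta>)) = \<zeta>"
  by (simp add: abs_less_iff Ln_exp)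

text \<open>The condition on \<open>B\<close> puts the excess above 3 for every admissible (a, b).
  The two expressions then agree on the circle, and continuity across it is enough for
  holomorphy.\<close>

lemma hyp_continuation_base:
  assumes c: "c \<notin> \<int>\<^sub>\<le>\<^sub>0" and B: "Re c > 2 * B + 3"
  shows "\<exists>H. hyp_continuation c B H"
proof -
  define H where "H = (\<lambda>a b w. if norm w \<le> 1 then hyp_series a b c w else hyp_right a b c (Ln (- w)))"
  define X :: "(complex \<times> complex \<times> complex) set" where "X = {(a, b, w). a - b \<notin> \<int> \<and> norm a < B \<and> norm b < B \<and> w \<in> slit_plane}"
  have pos: "Re (c - a - b) > 3" if "norm a < B" "norm b < B" for a b
    using B that abs_Re_le_cmod[of a] abs_Re_le_cmod[of b] by simp
  have X: "fst x - fst (snd x) \<notin> \<int>" "norm (fst x) < B" "norm (fst (snd x)) < B" "snd (snd x) \<in> slit_plane"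
     "Re (c - fst x - fst (snd x)) > 3" if "x \<in> X" for x
    using that pos by (auto simp: X_def)
  have X': "- (snd (snd x)) \<notin> \<real>\<^sub>\<le>\<^sub>0" if "x \<in> {x \<in> X. 1 \<le> norm (snd (snd x))}" for x
    using that X(4)[of x] slit_plane_iff[of "snd (snd x)"] by auto
  have bdry: "hyp_series a b c w = hyp_right a b c (Ln (- w))"
    if w: "norm w = 1" and ab: "a - b \<notin> \<int>" "norm a < B" "norm b < B" for a b w
  proof -
    define t where "t = Im (Ln (- w))"
    have nz: "- w \<noteq> 0" using w by auto
    have t: "t \<in> {-pi..pi}" using mpi_less_Im_Ln[OF nz] Im_Ln_le_pi[OF nz] by (simp add: t_def)
    have "Re (Ln (- w)) = 0" using nz w by (simp add: Re_Ln)
    hence L: "Ln (- w) = \<i> * of_real t" by (simp add: complex_eq_iff t_def)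
    have "w = - exp (\<i> * of_real t)" using exp_Ln[OF nz] L by simp
    thus ?thesis using hyp_arc[OF c ab(1) pos[OF ab(2,3)] t] L by simp
  qed
  have "continuous_on X (\<lambda>x. if norm (snd (snd x)) \<le> 1 then hyp_series (fst x) (fst (snd x)) c (snd (snd x))
            else hyp_right (fst x) (fst (snd x)) c (Ln (- snd (snd x))))"
  proof (rule continuous_on_cases_le)
    show "continuous_on {x \<in> X. norm (snd (snd x)) \<le> 1} (\<lambda>x. hyp_series (fst x) (fst (snd x)) c (snd (snd x)))"
      by (intro continuous_on_hyp_series continuous_intros) (use c X(5) in force)+
    show "continuous_on {x \<in> X. 1 \<le> norm (snd (snd x))} (\<lambda>x. hyp_right (fst x) (fst (snd x)) c (Ln (- snd (snd x))))"
    proof (intro continuous_on_hyp_right continuous_intros X')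
      fix x assume x: "x \<in> {x \<in> X. 1 \<le> norm (snd (snd x))}"
      show "0 \<le> Re (Ln (- snd (snd x)))" using x by (subst Re_Ln) auto
      show "0 < Re (Ln (- snd (snd x))) \<or> 0 < Re (c - fst x - fst (snd x))"
        using X(5)[of x] x by auto
    qed (use X(1) in auto)
    show "continuous_on X (\<lambda>x. norm (snd (snd x)))" by (intro continuous_intros)
  qed (use bdry X in auto)
  hence cont: "continuous_on X (\<lambda>x. H (fst x) (fst (snd x)) (snd (snd x)))" by (simp add: H_def)
  have right: "H a b (- exp \<zeta>) = hyp_right a b c \<zeta>"
    if "a - b \<notin> \<int>" "norm a < B" "norm b < B" "Re \<zeta> > 0" "\<bar>Im \<zeta>\<bar> < pi" for a b \<zeta>
    using that Ln_minus_exp[OF that(5)] by (simp add: H_def)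
  have hol: "H a b holomorphic_on slit_plane" if ab: "a - b \<notin> \<int>" "norm a < B" "norm b < B" for a b
  proof -
    define S where "S = {z. \<bar>Im z\<bar> < pi}"
    have "S = {z. Im z < pi} \<inter> {z. Im z > - pi}" by (auto simp: S_def)
    hence "open S" by (simp add: open_Int open_halfspace_Im_lt open_halfspace_Im_gt)
    \<comment> \<open>In \<zeta> the circle is a straight line, as the pasting theorem requires.
      This chart misses [0, 1), which the disc covers.\<close>
    have "(\<lambda>\<zeta>. H a b (- exp \<zeta>)) holomorphic_on S"
    proof (rule holomorphic_on_paste_across_line[OF \<open>open S\<close>, of 1 _ 0])
      have "(hyp_series a b c \<circ> (\<lambda>\<zeta>. - exp \<zeta>)) holomorphic_on (S \<inter> {z. 1 \<bullet> z < 0})"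
        by (rule holomorphic_on_compose_gen[OF _ holomorphic_hyp_series[OF c]])
           (auto intro!: holomorphic_intros simp: inner_complex_def)
      thus "(\<lambda>\<zeta>. H a b (- exp \<zeta>)) holomorphic_on (S \<inter> {z. 1 \<bullet> z < 0})"
        by (rule holomorphic_transform) (auto simp: H_def inner_complex_def)
      have "hyp_right a b c holomorphic_on (S \<inter> {z. 0 < 1 \<bullet> z})"
        by (rule holomorphic_on_subset[OF holomorphic_hyp_right[OF ab(1)]]) (auto simp: inner_complex_def)
      thus "(\<lambda>\<zeta>. H a b (- exp \<zeta>)) holomorphic_on (S \<inter> {z. 0 < 1 \<bullet> z})"
        by (rule holomorphic_transform) (use ab right in \<open>auto simp: S_def inner_complex_def\<close>)
      have "continuous_on S (\<lambda>\<zeta>. (a, b, - exp \<zeta>))" by (intro continuous_intros)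
      moreover have "(\<lambda>\<zeta>. (a, b, - exp \<zeta>)) ` S \<subseteq> X"
        using ab exp_slit_plane by (auto simp: X_def S_def)
      ultimately have "continuous_on S (\<lambda>\<zeta>. H (fst (a, b, - exp \<zeta>)) (fst (snd (a, b, - exp \<zeta>))) (snd (snd (a, b, - exp \<zeta>))))"
        by (rule continuous_on_compose2[OF cont])
      thus "continuous_on S (\<lambda>\<zeta>. H a b (- exp \<zeta>))" by simp
    qed auto
    hence "((\<lambda>\<zeta>. H a b (- exp \<zeta>)) \<circ> (\<lambda>w. Ln (- w))) holomorphic_on {w. - w \<notin> \<real>\<^sub>\<le>\<^sub>0}"
      by (intro holomorphic_on_compose_gen[where t = S] holomorphic_intros)
         (auto simp: S_def abs_Im_Ln_less_pi)
    hence "H a b holomorphic_on {w. - w \<notin> \<real>\<^sub>\<le>\<^sub>0}"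
    proof (rule holomorphic_transform)
      fix w :: complex assume "w \<in> {w. - w \<notin> \<real>\<^sub>\<le>\<^sub>0}"
      hence "- w \<noteq> 0" by auto
      from exp_Ln[OF this] show "((\<lambda>\<zeta>. H a b (- exp \<zeta>)) \<circ> (\<lambda>w. Ln (- w))) w = H a b w" by simp
    qed
    moreover have "H a b holomorphic_on ball 0 1"
      using holomorphic_hyp_series[OF c] by (rule holomorphic_transform) (auto simp: H_def)
    ultimately show ?thesis unfolding slit_plane_eq
      by (intro holomorphic_on_Un open_minus_notin_nonpos_Reals open_ball)
  qed
  have "hyp_continuation c B H"
    unfolding hyp_continuation_def X_def[symmetric]
    using cont hol right by (auto simp: case_prod_beta H_def)
  thus ?thesis by blast
qed

subsection \<open>Contiguous relations\<close>

lemma sums_0_iff: "(\<lambda>n. 0) sums x \<longleftrightarrow> x = (0 :: complex)"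
  using sums_unique2[OF _ sums_zero] sums_zero by blast

text \<open>It expresses the function at c through those at c + 1 and c + 2, where the excess is
  larger; the divisor 1 - w does not vanish on the slit plane.\<close>

lemma hyp_series_shift_c:
  assumes c: "c \<notin> \<int>\<^sub>\<le>\<^sub>0" and w: "norm w < 1"
  shows "c * (c + 1) * (1 - w) * hyp_series a b c w =
     (c + 1) * (c - (2 * c + 1 - a - b) * w) * hyp_series a b (c + 1) w +
     (c + 1 - a) * (c + 1 - b) * w * hyp_series a b (c + 2) w"
proof -
  have c1: "c + 1 \<notin> \<int>\<^sub>\<le>\<^sub>0" and c2: "c + 2 \<notin> \<int>\<^sub>\<le>\<^sub>0"
    using add_of_nat_notin_nonpos_Ints[OF c, of 1] add_of_nat_notin_nonpos_Ints[OF c, of 2] by simp_all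
  let ?k = "\<lambda>c. hyp_coeff a b c"
  have sm: "(\<lambda>n. ?k c n * w ^ n) sums hyp_series a b c w" if "c \<notin> \<int>\<^sub>\<le>\<^sub>0" for c
    using hyp_series_sums[OF that] w by blast
  have sS: "(\<lambda>n. ?k c (Suc n) * w ^ Suc n) sums (hyp_series a b c w - 1)" if "c \<notin> \<int>\<^sub>\<le>\<^sub>0" for c
    using sm[OF that] by (subst sums_Suc_iff) simp
  have zero: "c * (c + 1) * (?k c (Suc n) - ?k c n) - (c + 1) * (c * ?k (c + 1) (Suc n) - (2 * c + 1 - a - b) * ?k (c + 1) n)
      - (c + 1 - a) * (c + 1 - b) * ?k (c + 2) n = 0" for n
  proof -
    define N where "N = (of_nat n :: complex)"
    have nz: "c + N \<noteq> 0" "c + 1 + N \<noteq> 0" "1 + N \<noteq> 0"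
      using add_of_nat_neq_0[OF c, of n] add_of_nat_neq_0[OF c1, of n] of_nat_neq_0[of n, where 'a = complex]
      by (auto simp: N_def add_ac)
    \<comment> \<open>All coefficients involved are polynomial multiples of \<open>X\<close>, so the
      relation becomes a polynomial identity.\<close>
    define X where "X = ?k c n / ((c + N) * (c + 1 + N) * (1 + N))"
    have X0: "?k c n = X * ((c + N) * (c + 1 + N) * (1 + N))" using nz by (simp add: X_def)
    have rec: "(c + N) * (1 + N) * ?k c (Suc n) = (a + N) * (b + N) * ?k c n" if "c \<notin> \<int>\<^sub>\<le>\<^sub>0" for c
      using hyp_coeff_rec[OF that, of n a b] by (simp add: N_def)
    have "(c + N) * ?k (c + 1) n = (c + N) * (c * X * ((c + 1 + N) * (1 + N)))"
      using hyp_coeff_Suc_c[OF c, of n a b] unfolding X0 N_def[symmetric] by (simp only: mult_ac)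
    hence X1: "?k (c + 1) n = c * X * ((c + 1 + N) * (1 + N))"
      using nz by (simp only: mult_left_cancel simp_thms)
    have "(c + 1 + N) * ?k (c + 2) n = (c + 1) * ?k (c + 1) n"
      using hyp_coeff_Suc_c[OF c1, of n a b] by (simp add: N_def add_ac)
    hence "(c + 1 + N) * ?k (c + 2) n = (c + 1 + N) * (c * (c + 1) * X * (1 + N))"
      unfolding X1 by (simp only: mult_ac)
    hence X2: "?k (c + 2) n = c * (c + 1) * X * (1 + N)"
      using nz by (simp only: mult_left_cancel simp_thms)
    have "((c + N) * (1 + N)) * ?k c (Suc n) = ((c + N) * (1 + N)) * (X * (c + 1 + N) * ((a + N) * (b + N)))"
      using rec[OF c] unfolding X0 by (simp only: mult_ac)
    hence X3: "?k c (Suc n) = X * (c + 1 + N) * ((a + N) * (b + N))"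
      using nz by (simp only: mult_left_cancel mult_eq_0_iff simp_thms)
    have "((c + 1 + N) * (1 + N)) * ?k (c + 1) (Suc n) = ((c + 1 + N) * (1 + N)) * (c * X * ((a + N) * (b + N)))"
      using rec[OF c1] unfolding X1 by (simp only: mult_ac)
    hence X4: "?k (c + 1) (Suc n) = c * X * ((a + N) * (b + N))"
      using nz by (simp only: mult_left_cancel mult_eq_0_iff simp_thms)
    show ?thesis unfolding X0 X1 X2 X3 X4 by (simp add: algebra_simps)
  qed
  have "(\<lambda>n. c * (c + 1) * (?k c (Suc n) * w ^ Suc n - w * (?k c n * w ^ n))
      - (c + 1) * (c * (?k (c + 1) (Suc n) * w ^ Suc n) - (2 * c + 1 - a - b) * (w * (?k (c + 1) n * w ^ n)))
      - (c + 1 - a) * (c + 1 - b) * (w * (?k (c + 2) n * w ^ n))) sums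
     (c * (c + 1) * ((hyp_series a b c w - 1) - w * hyp_series a b c w)
      - (c + 1) * (c * (hyp_series a b (c + 1) w - 1) - (2 * c + 1 - a - b) * (w * hyp_series a b (c + 1) w))
      - (c + 1 - a) * (c + 1 - b) * (w * hyp_series a b (c + 2) w))"
    by (intro sums_diff sums_mult sm sS c c1 c2)
  moreover have "(\<lambda>n. c * (c + 1) * (?k c (Suc n) * w ^ Suc n - w * (?k c n * w ^ n))
      - (c + 1) * (c * (?k (c + 1) (Suc n) * w ^ Suc n) - (2 * c + 1 - a - b) * (w * (?k (c + 1) n * w ^ n)))
      - (c + 1 - a) * (c + 1 - b) * (w * (?k (c + 2) n * w ^ n))) = (\<lambda>n. 0)"
  proof
    fix n
    have "p * (x * (w * v) - w * (y * v)) - q * (c * (x' * (w * v)) - r * (w * (y' * v))) - l * m * (w * (y'' * v))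
      = (p * (x - y) - q * (c * x' - r * y') - l * m * y'') * (w * v)" for p q r l m x y x' y' y'' v
      by (simp add: algebra_simps)
    thus "c * (c + 1) * (?k c (Suc n) * w ^ Suc n - w * (?k c n * w ^ n))
      - (c + 1) * (c * (?k (c + 1) (Suc n) * w ^ Suc n) - (2 * c + 1 - a - b) * (w * (?k (c + 1) n * w ^ n)))
      - (c + 1 - a) * (c + 1 - b) * (w * (?k (c + 2) n * w ^ n)) = 0"
      unfolding power_Suc by (simp only: zero mult_zero_left)
  qed
  ultimately have "c * (c + 1) * ((hyp_series a b c w - 1) - w * hyp_series a b c w)
      - (c + 1) * (c * (hyp_series a b (c + 1) w - 1) - (2 * c + 1 - a - b) * (w * hyp_series a b (c + 1) w))
      - (c + 1 - a) * (c + 1 - b) * (w * hyp_series a b (c + 2) w) = 0"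
    by (simp only: sums_0_iff)
  thus ?thesis by (simp add: algebra_simps)
qed

text \<open>Raising c by 1 lowers the second parameter a - c + 1 of the series at infinity and fixes
  the other two, so the expansion at infinity needs contiguity in that slot.\<close>

lemma hyp_series_shift_b:
  assumes c: "c \<notin> \<int>\<^sub>\<le>\<^sub>0" and w: "norm w < 1"
  shows "(c - b) * hyp_series a (b - 1) c w + (2 * b - c + (a - b) * w) * hyp_series a b c w
           + b * (w - 1) * hyp_series a (b + 1) c w = 0"
proof -
  let ?k = "\<lambda>b. hyp_coeff a b c"
  have sm: "(\<lambda>n. ?k b n * w ^ n) sums hyp_series a b c w" for b
    using hyp_series_sums[OF c] w by blast
  have sS: "(\<lambda>n. ?k b (Suc n) * w ^ Suc n) sums (hyp_series a b c w - 1)" for b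
    using sm by (subst sums_Suc_iff) simp
  have zero: "(c - b) * ?k (b - 1) (Suc n) + ((2 * b - c) * ?k b (Suc n) + (a - b) * ?k b n)
           + b * (?k (b + 1) n - ?k (b + 1) (Suc n)) = 0" for n
  proof -
    define N where "N = (of_nat n :: complex)"
    have nz: "c + N \<noteq> 0" "1 + N \<noteq> 0"
      using add_of_nat_neq_0[OF c, of n] of_nat_neq_0[of n, where 'a = complex]
      by (auto simp: N_def add_ac)
    define X where "X = ?k b n / ((c + N) * (1 + N))"
    have p: "pochhammer (b - 1) (Suc n) = (b - 1) * pochhammer b n"
      using pochhammer_rec[of "b - 1" n] by simp
    have q: "b * pochhammer (b + 1) n = (b + N) * pochhammer b n"
      using pochhammer_rec[of b n] pochhammer_rec'[of b n] by (simp add: N_def)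
    have X0: "?k b n = X * ((c + N) * (1 + N))" using nz by (simp add: X_def)
    have cancel: "P / ((c + N) * (1 + N)) * (X * ((c + N) * (1 + N))) = X * P" for P
      using nz by simp
    have "?k b (Suc n) = (a + N) * (b + N) / ((c + N) * (1 + N)) * ?k b n"
      by (simp add: hyp_coeff_Suc N_def)
    hence X1: "?k b (Suc n) = X * ((a + N) * (b + N))"
      unfolding X0 cancel .
    have Y: "pochhammer b n * (pochhammer a n / (pochhammer c n * fact n)) = X * ((c + N) * (1 + N))"
      using X0 by (simp add: hyp_coeff_def mult_ac)
    have X2: "?k (b - 1) (Suc n) = X * ((a + N) * (b - 1))"
    proof -
      have "?k (b - 1) (Suc n) = (b - 1) * (a + N) / ((c + N) * (1 + N)) * (pochhammer b n * (pochhammer a n / (pochhammer c n * fact n)))"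
        unfolding hyp_coeff_def p by (simp add: pochhammer_Suc N_def mult_ac)
      thus ?thesis unfolding Y cancel by (simp only: mult_ac)
    qed
    \<comment> \<open>The factor \<open>b\<close> stays on the left: it may be 0 and cannot be
      divided out.\<close>
    have X3: "b * ?k (b + 1) n = X * ((c + N) * (1 + N)) * (b + N)"
    proof -
      have "b * ?k (b + 1) n = (b * pochhammer (b + 1) n) * (pochhammer a n / (pochhammer c n * fact n))"
        by (simp add: hyp_coeff_def)
      also have "\<dots> = (b + N) * (pochhammer b n * (pochhammer a n / (pochhammer c n * fact n)))"
        unfolding q by (simp only: mult_ac)
      finally show ?thesis unfolding Y by (simp add: mult_ac)
    qed
    have X4: "b * ?k (b + 1) (Suc n) = X * (b + N) * ((a + N) * (b + 1 + N))"
    proof -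
      have "b * ?k (b + 1) (Suc n) = (a + N) * (b + 1 + N) / ((c + N) * (1 + N)) * (b * ?k (b + 1) n)"
        by (simp add: hyp_coeff_Suc N_def)
      also have "\<dots> = (b + N) * ((a + N) * (b + 1 + N) / ((c + N) * (1 + N)) * (X * ((c + N) * (1 + N))))"
        unfolding X3 by (simp only: mult_ac)
      finally show ?thesis unfolding cancel by (simp only: mult_ac)
    qed
    show ?thesis unfolding right_diff_distrib[of b] X0 X1 X2 X3 X4 by (simp add: algebra_simps)
  qed
  have "(\<lambda>n. (c - b) * (?k (b - 1) (Suc n) * w ^ Suc n) + ((2 * b - c) * (?k b (Suc n) * w ^ Suc n) + (a - b) * (w * (?k b n * w ^ n)))
           + b * (w * (?k (b + 1) n * w ^ n) - ?k (b + 1) (Suc n) * w ^ Suc n)) sums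
      ((c - b) * (hyp_series a (b - 1) c w - 1) + ((2 * b - c) * (hyp_series a b c w - 1) + (a - b) * (w * hyp_series a b c w))
           + b * (w * hyp_series a (b + 1) c w - (hyp_series a (b + 1) c w - 1)))"
    by (intro sums_add sums_diff sums_mult sm sS)
  moreover have "(\<lambda>n. (c - b) * (?k (b - 1) (Suc n) * w ^ Suc n) + ((2 * b - c) * (?k b (Suc n) * w ^ Suc n) + (a - b) * (w * (?k b n * w ^ n)))
           + b * (w * (?k (b + 1) n * w ^ n) - ?k (b + 1) (Suc n) * w ^ Suc n)) = (\<lambda>n. 0)"
  proof
    fix n
    have "p * (x * (w * v)) + (q * (y * (w * v)) + r * (w * (y' * v))) + b * (w * (z * v) - z' * (w * v))
       = (p * x + (q * y + r * y') + b * (z - z')) * (w * v)" for p q r x y y' z z' v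
      by (simp add: algebra_simps)
    thus "(c - b) * (?k (b - 1) (Suc n) * w ^ Suc n) + ((2 * b - c) * (?k b (Suc n) * w ^ Suc n) + (a - b) * (w * (?k b n * w ^ n)))
           + b * (w * (?k (b + 1) n * w ^ n) - ?k (b + 1) (Suc n) * w ^ Suc n) = 0"
      unfolding power_Suc by (simp only: zero mult_zero_left)
  qed
  ultimately have "(c - b) * (hyp_series a (b - 1) c w - 1) + ((2 * b - c) * (hyp_series a b c w - 1) + (a - b) * (w * hyp_series a b c w))
           + b * (w * hyp_series a (b + 1) c w - (hyp_series a (b + 1) c w - 1)) = 0"
    by (simp only: sums_0_iff)
  thus ?thesis by (simp add: algebra_simps)
qed

text \<open>The Gamma factors of \<open>conn\<close> contribute (c - a) (c + 1 - a), c (c + 1 - a)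
  and c (c + 1) at the three values of c. They convert contiguity in the second parameter at 1 / w
  into the very relation that the series at w satisfies.\<close>

lemma hyp_right_shift_aux:
  assumes c: "c \<notin> \<int>\<^sub>\<le>\<^sub>0" and ab: "a - b \<notin> \<int>" and \<zeta>: "Re \<zeta> > 0"
  defines "w \<equiv> - exp \<zeta>"
  defines "T \<equiv> \<lambda>c. conn a b c * hyp_inf a b c \<zeta>"
  shows "c * (c + 1) * (1 - w) * T c =
     (c + 1) * (c - (2 * c + 1 - a - b) * w) * T (c + 1) + (c + 1 - a) * (c + 1 - b) * w * T (c + 2)"
proof -
  have c1: "c + 1 \<notin> \<int>\<^sub>\<le>\<^sub>0" using add_of_nat_notin_nonpos_Ints[OF c, of 1] by simp
  define z where "z = - exp (- \<zeta>)"
  have zw: "z * w = 1" by (simp add: z_def w_def flip: exp_add)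
  have z: "norm z < 1" using \<zeta> by (simp add: z_def)
  define V where "V = (\<lambda>c. hyp_series a (a - c + 1) (a - b + 1) z)"
  define X where "X = Gamma c * Gamma (b - a) * rGamma b * rGamma (c + 2 - a) * exp (- a * \<zeta>)"
  have G1: "Gamma (c + 1) = c * Gamma c" by (rule Gamma_plus1[OF c])
  have G2: "Gamma (c + 2) = (c + 1) * (c * Gamma c)"
    using Gamma_plus1[OF c1] G1 by (simp add: add.assoc)
  have r1: "rGamma (c + 1 - a) = (c + 1 - a) * rGamma (c + 2 - a)"
    using rGamma_plus1[of "c + 1 - a"] by (simp add: algebra_simps)
  have r0: "rGamma (c - a) = (c - a) * ((c + 1 - a) * rGamma (c + 2 - a))"
    unfolding r1[symmetric] using rGamma_plus1[of "c - a", symmetric] by (simp only: diff_add_eq)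
  have inf: "hyp_inf a b c \<zeta> = exp (- a * \<zeta>) * V c" for c
    by (simp add: hyp_inf_altdef V_def z_def)
  have T0: "T c = (c - a) * (c + 1 - a) * X * V c"
    unfolding T_def conn_def inf r0 X_def by (simp only: mult_ac)
  have T1: "T (c + 1) = c * (c + 1 - a) * X * V (c + 1)"
    unfolding T_def conn_def inf r1 G1 X_def by (simp only: mult_ac)
  have T2: "T (c + 2) = c * (c + 1) * X * V (c + 2)"
    unfolding T_def conn_def inf G2 X_def by (simp only: mult_ac)
  \<comment> \<open>Contiguity centred at a - c, the second parameter belonging to c + 1.\<close>
  have "(a - b + 1 - (a - c)) * hyp_series a (a - c - 1) (a - b + 1) z
      + (2 * (a - c) - (a - b + 1) + (a - (a - c)) * z) * hyp_series a (a - c) (a - b + 1) z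
      + (a - c) * (z - 1) * hyp_series a (a - c + 1) (a - b + 1) z = 0"
    by (rule hyp_series_shift_b[OF nonint_diff[OF ab] z])
  hence *: "(c + 1 - b) * V (c + 2) + (a + b - 2 * c - 1 + c * z) * V (c + 1) + (a - c) * (z - 1) * V c = 0"
    by (simp add: V_def algebra_simps)
  \<comment> \<open>Multiplying by w and using z * w = 1 returns from the variable 1 / w to
    w.\<close>
  have "w * ((c + 1 - b) * v2 + (a + b - 2 * c - 1 + c * z) * v1 + (a - c) * (z - 1) * v0)
     = (c + 1 - b) * w * v2 + ((a + b - 2 * c - 1) * w + c * (z * w)) * v1 + (a - c) * (z * w - w) * v0"
     for v0 v1 v2 by (simp add: algebra_simps)
  from this[of "V (c + 2)" "V (c + 1)" "V c"]
  have **: "(c + 1 - b) * w * V (c + 2) + ((a + b - 2 * c - 1) * w + c) * V (c + 1) + (a - c) * (1 - w) * V c = 0"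
    unfolding * zw by simp
  have "c * (c + 1) * (1 - w) * T c - ((c + 1) * (c - (2 * c + 1 - a - b) * w) * T (c + 1) + (c + 1 - a) * (c + 1 - b) * w * T (c + 2))
     = - (c * (c + 1) * (c + 1 - a) * X) * ((c + 1 - b) * w * V (c + 2) + ((a + b - 2 * c - 1) * w + c) * V (c + 1) + (a - c) * (1 - w) * V c)"
    unfolding T0 T1 T2 by (simp add: algebra_simps)
  also have "\<dots> = 0" unfolding ** by simp
  finally show ?thesis by simp
qed

lemma hyp_right_shift:
  assumes c: "c \<notin> \<int>\<^sub>\<le>\<^sub>0" and ab: "a - b \<notin> \<int>" and \<zeta>: "Re \<zeta> > 0"
  defines "w \<equiv> - exp \<zeta>"
  shows "c * (c + 1) * (1 - w) * hyp_right a b c \<zeta> =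
     (c + 1) * (c - (2 * c + 1 - a - b) * w) * hyp_right a b (c + 1) \<zeta>
       + (c + 1 - a) * (c + 1 - b) * w * hyp_right a b (c + 2) \<zeta>"
proof -
  have ba: "b - a \<notin> \<int>" using minus_notin_Ints_commute[OF ab] .
  have lin: "k * (x + x') = l * (y + y') + m * (z + z')"
    if "k * x = l * y + m * z" "k * x' = l * y' + m * z'" for k l m x x' y y' z z' :: complex
    using that by (simp add: algebra_simps)
  have "c * (c + 1) * (1 - w) * (conn b a c * hyp_inf b a c \<zeta>) =
     (c + 1) * (c - (2 * c + 1 - a - b) * w) * (conn b a (c + 1) * hyp_inf b a (c + 1) \<zeta>)
       + (c + 1 - a) * (c + 1 - b) * w * (conn b a (c + 2) * hyp_inf b a (c + 2) \<zeta>)"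
    using hyp_right_shift_aux[OF c ba \<zeta>] unfolding w_def[symmetric] 
    by (simp only: mult_ac diff_diff_eq add.commute[of b a])
  from lin[OF hyp_right_shift_aux[OF c ab \<zeta>, folded w_def] this]
  show ?thesis unfolding hyp_right_def .
qed

text \<open>The series and the expansion at infinity obey the same relation in c, so solving it for
  the function at c carries both local descriptions along.\<close>

lemma hyp_continuation_shift:
  assumes c: "c \<notin> \<int>\<^sub>\<le>\<^sub>0" and H1: "hyp_continuation (c + 1) B H1" and H2: "hyp_continuation (c + 2) B H2"
  shows "\<exists>H. hyp_continuation c B H"
proof -
  define H where "H = (\<lambda>a b w. ((c + 1) * (c - (2 * c + 1 - a - b) * w) * H1 a b w +
       (c + 1 - a) * (c + 1 - b) * w * H2 a b w) / (c * (c + 1) * (1 - w)))"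
  define X :: "(complex \<times> complex \<times> complex) set"
    where "X = {(a, b, w). a - b \<notin> \<int> \<and> norm a < B \<and> norm b < B \<and> w \<in> slit_plane}"
  have c0: "c \<noteq> 0" "c + 1 \<noteq> 0" using add_of_nat_neq_0[OF c, of 0] add_of_nat_neq_0[OF c, of 1] by auto
  have w1: "w \<noteq> 1" if "w \<in> slit_plane" for w
    using that by (auto simp: image_iff dest: bspec[of _ _ 1])
  have solve: "x = (p + q) / (c * (c + 1) * (1 - w))" if "w \<noteq> 1" "c * (c + 1) * (1 - w) * x = p + q" for x p q w
    using that c0 by (simp add: eq_divide_eq mult_ac)
  have C1: "continuous_on X (\<lambda>x. H1 (fst x) (fst (snd x)) (snd (snd x)))"
   and C2: "continuous_on X (\<lambda>x. H2 (fst x) (fst (snd x)) (snd (snd x)))"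
    using H1 H2 unfolding hyp_continuation_def X_def by (simp_all add: case_prod_beta)
  have "continuous_on X (\<lambda>x. H (fst x) (fst (snd x)) (snd (snd x)))"
    unfolding H_def by (intro continuous_intros C1 C2) (use c0 w1 in \<open>auto simp: X_def\<close>)
  moreover have "H a b holomorphic_on slit_plane" if "a - b \<notin> \<int>" "norm a < B" "norm b < B" for a b
    unfolding H_def using H1 H2 that c0 w1 unfolding hyp_continuation_def
    by (intro holomorphic_intros) auto
  moreover have "H a b w = hyp_series a b c w" if "a - b \<notin> \<int>" "norm a < B" "norm b < B" "norm w < 1" for a b w
  proof -
    have e: "H1 a b w = hyp_series a b (c + 1) w" "H2 a b w = hyp_series a b (c + 2) w"
      using H1 H2 that unfolding hyp_continuation_def by simp_all
    have "w \<noteq> 1" using that by auto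
    from solve[OF this hyp_series_shift_c[OF c that(4)]] show ?thesis unfolding H_def e by (rule sym)
  qed
  moreover have "H a b (- exp \<zeta>) = hyp_right a b c \<zeta>"
    if "a - b \<notin> \<int>" "norm a < B" "norm b < B" "Re \<zeta> > 0" "\<bar>Im \<zeta>\<bar> < pi" for a b \<zeta>
  proof -
    have "H1 a b (- exp \<zeta>) = hyp_right a b (c + 1) \<zeta>" "H2 a b (- exp \<zeta>) = hyp_right a b (c + 2) \<zeta>"
      using H1 H2 that unfolding hyp_continuation_def by blast+
    moreover have "- exp \<zeta> \<noteq> 1" using w1 exp_slit_plane[OF that(5)] by blast
    ultimately show ?thesis unfolding H_def
      using solve[OF _ hyp_right_shift[OF c that(1,4)]] by simp
  qed
  ultimately have "hyp_continuation c B H"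
    unfolding hyp_continuation_def X_def[symmetric] by (auto simp: case_prod_beta)
  thus ?thesis by blast
qed

lemma hyp_continuation_exists:
  assumes "c \<notin> \<int>\<^sub>\<le>\<^sub>0"
  shows "\<exists>H. hyp_continuation c B H"
proof -
  \<comment> \<open>\<open>n\<close> bounds the distance of Re c from the range of the base case;
    passing to c + 1 or c + 2 brings it within reach of the induction hypothesis.\<close>
  have "\<exists>H. hyp_continuation c B H" if "c \<notin> \<int>\<^sub>\<le>\<^sub>0" "Re c + real n > 2 * B + 3" for n c
    using that
  proof (induction n arbitrary: c)
    case 0
    thus ?case using hyp_continuation_base by simp
  next
    case (Suc n)
    have "\<exists>H. hyp_continuation (c + of_nat k) B H" if "k \<ge> 1" for k
      by (rule Suc.IH[OF add_of_nat_notin_nonpos_Ints[OF Suc.prems(1)]]) (use Suc.prems that in auto)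
    from this[of 1] this[of 2] show ?case using hyp_continuation_shift[OF Suc.prems(1)] by auto
  qed
  moreover obtain n where "real n > 2 * B + 3 - Re c" using reals_Archimedean2 by blast
  ultimately show ?thesis using assms by (metis add.commute less_diff_eq diff_less_eq)
qed

subsection \<open>Integer parameter differences\<close>

text \<open>The Leibniz rule wants a jointly continuous derivative in w. Cauchy's formula on a fixed
  circle writes that derivative as an integral of f, so joint continuity of f is enough.\<close>

lemma holomorphic_integral_param:
  fixes f :: "complex \<Rightarrow> real \<Rightarrow> complex"
  assumes S: "open S" and cont: "continuous_on (S \<times> {0..1}) (\<lambda>(w, t). f w t)"
    and hol: "\<And>t. t \<in> {0..1} \<Longrightarrow> (\<lambda>w. f w t) holomorphic_on S"
  shows "(\<lambda>w. integral {0..1} (f w)) holomorphic_on S"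
proof -
  have "\<exists>U. open U \<and> w0 \<in> U \<and> (\<lambda>w. integral {0..1} (f w)) holomorphic_on U" if "w0 \<in> S" for w0
  proof -
    obtain r where r: "r > 0" "cball w0 r \<subseteq> S" using S \<open>w0 \<in> S\<close> open_contains_cball by blast
    define g where "g = circlepath w0 r"
    have gS: "g x \<in> S" and gn: "norm (g x - w0) = r" for x
    proof -
      show "norm (g x - w0) = r" using r by (simp add: g_def circlepath norm_mult)
      hence "g x \<in> cball w0 r" by (simp add: dist_norm norm_minus_commute)
      thus "g x \<in> S" using r by blast
    qed
    define D where "D = (\<lambda>x. 2 * of_real pi * \<i> * of_real r * exp (2 * of_real pi * \<i> * complex_of_real x))"
    have vd: "vector_derivative g (at x) = D x" for x
      by (simp add: g_def vector_derivative_circlepath D_def)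
    define fx where "fx = (\<lambda>w t. 1 / (2 * of_real pi * \<i>) * integral {0..1} (\<lambda>x. f (g x) t / (g x - w)\<^sup>2 * D x))"
    have "(\<lambda>w. integral (cbox 0 1) (f w)) holomorphic_on ball w0 r"
    proof (rule leibniz_rule_holomorphic)
      fix w t assume w: "w \<in> ball w0 r" and t: "t \<in> cbox 0 (1::real)"
      have h: "(\<lambda>w. f w t) holomorphic_on S" using hol t by simp
      have "((\<lambda>w. f w t) has_field_derivative (1 / (2 * of_real pi * \<i>) * contour_integral g (\<lambda>u. f u t / (u - w)\<^sup>2))) (at w)"
        unfolding g_def
      proof (rule Cauchy_derivative_integral_circlepath(2)[OF _ _ w])
        show "continuous_on (cball w0 r) (\<lambda>w. f w t)"
          using holomorphic_on_subset[OF h r(2)] by (rule holomorphic_on_imp_continuous_on)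
        show "(\<lambda>w. f w t) holomorphic_on ball w0 r"
          using holomorphic_on_subset[OF h] r(2) ball_subset_cball by blast
      qed
      also have "1 / (2 * of_real pi * \<i>) * contour_integral g (\<lambda>u. f u t / (u - w)\<^sup>2) = fx w t"
        by (simp add: fx_def contour_integral_integral vd)
      finally show "((\<lambda>w. f w t) has_field_derivative fx w t) (at w within ball w0 r)"
        by (rule has_field_derivative_at_within)
    next
      fix w assume "w \<in> ball w0 r"
      hence "w \<in> S" using r by auto
      have "continuous_on (cbox 0 1) (\<lambda>t. (w, t))" by (intro continuous_intros)
      from continuous_on_compose2[OF cont this] have "continuous_on (cbox 0 1) (f w)"
        using \<open>w \<in> S\<close> by auto
      thus "f w integrable_on cbox 0 1" by (rule integrable_continuous)
    next
      have c1: "continuous_on Y (\<lambda>y. f (p y) (q y))" if "continuous_on Y p" "continuous_on Y q"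
        "\<And>y. y \<in> Y \<Longrightarrow> p y \<in> S \<and> q y \<in> {0..1}" for Y :: "((complex \<times> real) \<times> real) set" and p q
        using continuous_on_compose2[OF cont continuous_on_Pair[OF that(1,2)]] that(3) by force
      have C: "continuous_on ((ball w0 r \<times> cbox (0::real) (1::real)) \<times> cbox (0::real) (1::real)) (\<lambda>(y, x). f (g x) (snd y) / (g x - fst y)\<^sup>2 * D x)"
      proof -
        let ?Y = "(ball w0 r \<times> cbox (0::real) (1::real)) \<times> cbox (0::real) (1::real)"
        have cg: "continuous_on ?Y (\<lambda>y. g (snd y))" unfolding g_def circlepath by (intro continuous_intros)
        have cD: "continuous_on ?Y (\<lambda>y. D (snd y))" unfolding D_def by (intro continuous_intros)
        have cf: "continuous_on ?Y (\<lambda>y. f (g (snd y)) (snd (fst y)))"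
          by (intro c1 cg continuous_intros) (auto simp: gS)
        have cd: "continuous_on ?Y (\<lambda>y. (g (snd y) - fst (fst y))\<^sup>2)"
          by (intro continuous_on_power continuous_on_diff cg continuous_intros)
        have nz: "\<forall>y\<in>?Y. (g (snd y) - fst (fst y))\<^sup>2 \<noteq> 0"
        proof (rule ballI)
          fix y :: "(complex \<times> real) \<times> real" assume "y \<in> ?Y"
          hence "norm (fst (fst y) - w0) < r" by (auto simp: dist_norm norm_minus_commute)
          thus "(g (snd y) - fst (fst y))\<^sup>2 \<noteq> 0" using gn[of "snd y"] by auto
        qed
        have "continuous_on ?Y (\<lambda>y. f (g (snd y)) (snd (fst y)) / (g (snd y) - fst (fst y))\<^sup>2 * D (snd y))"
          by (rule continuous_on_mult[OF continuous_on_divide[OF cf cd nz] cD])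
        thus ?thesis by (simp add: case_prod_beta)
      qed
      have "continuous_on (ball w0 r \<times> cbox 0 1) (\<lambda>y. 1 / (2 * of_real pi * \<i>) * integral (cbox 0 1) (\<lambda>x. f (g x) (snd y) / (g x - fst y)\<^sup>2 * D x))"
        by (intro continuous_on_mult continuous_on_const integral_continuous_on_param[OF C])
      thus "continuous_on (ball w0 r \<times> cbox 0 1) (\<lambda>(w, t). fx w t)"
        by (simp add: fx_def case_prod_beta)
    qed simp
    thus ?thesis using r by (intro exI[of _ "ball w0 r"]) auto
  qed
  thus ?thesis unfolding holomorphic_on_open[OF S] using holomorphic_on_open by blast
qed

lemma circle_mean_value:
  assumes "f holomorphic_on UNIV" "r > 0"
  shows "integral {0..1} (\<lambda>x. f (of_real r * exp (2 * of_real pi * \<i> * of_real x))) = f 0"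
proof -
  have "((\<lambda>u. f u / (u - 0)) has_contour_integral (2 * of_real pi * \<i> * f 0)) (circlepath 0 r)"
    by (rule Cauchy_integral_circlepath)
       (use assms in \<open>auto intro: holomorphic_on_imp_continuous_on holomorphic_on_subset\<close>)
  hence "2 * of_real pi * \<i> * f 0 = contour_integral (circlepath 0 r) (\<lambda>u. f u / u)"
    using contour_integral_unique by fastforce
  also have "\<dots> = integral {0..1} (\<lambda>x. 2 * of_real pi * \<i> * f (of_real r * exp (2 * of_real pi * \<i> * of_real x)))"
    unfolding contour_integral_integral vector_derivative_circlepath
    using assms(2) by (intro arg_cong[of _ _ "integral {0..1}"]) (auto simp: circlepath)
  also have "\<dots> = 2 * of_real pi * \<i> * integral {0..1} (\<lambda>x. f (of_real r * exp (2 * of_real pi * \<i> * of_real x)))"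
    by (rule integral_mult_right)
  finally show ?thesis by simp
qed

text \<open>The partial sums are polynomials in t, and the locally uniform coefficient bound makes
  them converge locally uniformly. This feeds the mean value property in t.\<close>

lemma holomorphic_hyp_series_param:
  assumes c: "c \<notin> \<int>\<^sub>\<le>\<^sub>0" and w: "norm w < 1"
  shows "(\<lambda>t. hyp_series (a + t) (b - t) c w) holomorphic_on UNIV"
proof (rule holomorphic_uniform_sequence[OF open_UNIV])
  show "(\<lambda>t. \<Sum>n<N. hyp_coeff (a + t) (b - t) c n * w ^ n) holomorphic_on UNIV" for N
    unfolding hyp_coeff_def pochhammer_prod
    by (intro holomorphic_intros) (use pochhammer_neq_0[OF c] in \<open>simp_all add: pochhammer_prod[symmetric]\<close>)
next
  fix x :: complex
  define q where "q = Re (a + x + (b - x) - c)"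
  obtain C where C: "C > 0"
    "eventually (\<lambda>t. \<forall>n. norm (hyp_coeff (a + t) (b - t) c n) \<le> C * (real n + 1) powr q) (nhds x)"
  proof (rule hyp_coeff_bound[OF _ _ _ c])
    show "((\<lambda>t. a + t) \<longlongrightarrow> a + x) (nhds x)" "((\<lambda>t. b - t) \<longlongrightarrow> b - x) (nhds x)" "((\<lambda>t. c) \<longlongrightarrow> c) (nhds x)"
      by (intro tendsto_intros filterlim_ident)+
  qed (auto simp: q_def)
  then obtain d where d: "d > 0" "\<And>t. dist t x < d \<Longrightarrow> \<forall>n. norm (hyp_coeff (a + t) (b - t) c n) \<le> C * (real n + 1) powr q"
    unfolding eventually_nhds_metric by blast
  have "uniform_limit (cball x (d / 2)) (\<lambda>N t. \<Sum>n<N. hyp_coeff (a + t) (b - t) c n * w ^ n)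
           (\<lambda>t. \<Sum>n. hyp_coeff (a + t) (b - t) c n * w ^ n) sequentially"
  proof (rule Weierstrass_m_test)
    fix n t assume "t \<in> cball x (d / 2)"
    hence "dist t x < d" using d(1) by (simp add: dist_commute)
    hence "norm (hyp_coeff (a + t) (b - t) c n) * norm w ^ n \<le> C * (real n + 1) powr q * norm w ^ n"
      using d(2) by (intro mult_right_mono) auto
    thus "norm (hyp_coeff (a + t) (b - t) c n * w ^ n) \<le> C * ((real n + 1) powr q * norm w ^ n)"
      by (simp add: norm_mult norm_power mult_ac)
  next
    show "summable (\<lambda>n. C * ((real n + 1) powr q * norm w ^ n))"
      by (intro summable_mult summable_powr_mult_power w) auto
  qed
  thus "\<exists>d>0. cball x d \<subseteq> UNIV \<and> uniform_limit (cball x d) (\<lambda>N t. \<Sum>n<N. hyp_coeff (a + t) (b - t) c n * w ^ n)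
           (\<lambda>t. hyp_series (a + t) (b - t) c w) sequentially"
    using d(1) unfolding hyp_series_def by (intro exI[of _ "d / 2"]) auto
qed

lemma connected_slit_plane: "connected slit_plane"
proof (rule starlike_imp_connected)
  show "starlike slit_plane" unfolding starlike_def
  proof (rule bexI[of _ 0], intro ballI subsetI)
    fix x y assume x: "x \<in> slit_plane" and y: "y \<in> closed_segment 0 x"
    then obtain u where u: "0 \<le> u" "u \<le> 1" "y = of_real u * x"
      by (auto simp: closed_segment_def scaleR_conv_of_real)
    show "y \<in> slit_plane"
    proof
      assume "y \<in> complex_of_real ` {1..}"
      then obtain r where r: "r \<ge> 1" "y = of_real r" by auto
      have "u > 0" using u r by (cases "u = 0") auto
      hence "x = of_real (r / u)" using u r by (simp add: field_simps)
      moreover have "r / u \<ge> 1" using r u \<open>u > 0\<close> by (simp add: field_simps)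
      ultimately have "x \<in> complex_of_real ` {1..}" by (intro image_eqI[of _ _ "r / u"]) simp_all
      thus False using x by blast
    qed
  qed auto
qed

text \<open>Radius 1/8 moves a - b by 2 t of modulus 1/4. If a and b lie within 1/16 of parameters
  with integer difference, a - b + 2 t stays at distance between 1/8 and 3/8 from that integer,
  hence off all integers.\<close>

abbreviation circ :: "real \<Rightarrow> complex" where
  "circ \<tau> \<equiv> of_real (1 / 8) * exp (2 * of_real pi * \<i> * of_real \<tau>)"

lemma norm_circ: "norm (circ \<tau>) = 1 / 8"
  by (simp add: norm_mult)

lemma circ_nonint:
  assumes "a0 - b0 \<in> \<int>" "norm (a - a0) < 1 / 16" "norm (b - b0) < 1 / 16"
  shows "(a + circ \<tau>) - (b - circ \<tau>) \<notin> \<int>"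
proof
  define u where "u = (a - a0) - (b - b0) + 2 * circ \<tau>"
  assume "(a + circ \<tau>) - (b - circ \<tau>) \<in> \<int>"
  hence "(a + circ \<tau>) - (b - circ \<tau>) - (a0 - b0) \<in> \<int>" using assms(1) by (rule Ints_diff)
  also have "(a + circ \<tau>) - (b - circ \<tau>) - (a0 - b0) = u" by (simp add: u_def algebra_simps)
  finally obtain m where m: "u = of_int m" by (elim Ints_cases)
  have d: "norm ((a - a0) - (b - b0)) < 1 / 8" using norm_triangle_ineq4[of "a - a0" "b - b0"] assms by simp
  have e: "norm (2 * circ \<tau>) = 1 / 4" using norm_circ[of \<tau>] by (simp only: norm_mult) simp
  have "norm u < 1" unfolding u_def
    using norm_triangle_ineq[of "(a - a0) - (b - b0)" "2 * circ \<tau>"] d e by linarith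
  hence "\<bar>of_int m\<bar> < (1::real)" using m by simp
  hence "u = 0" using m by simp
  moreover have "norm u > 0" unfolding u_def
    using norm_diff_ineq[of "2 * circ \<tau>" "(a - a0) - (b - b0)"] d e by (simp only: add.commute)
  ultimately show False by simp
qed

text \<open>The second bound is applied to b and \<open>b0\<close>, which explains the order of its
  summands.\<close>

lemma circ_bound:
  assumes "norm (a - a0) < 1 / 16"
  shows "norm (a + circ \<tau>) < norm a0 + norm b0 + 1" "norm (a - circ \<tau>) < norm b0 + norm a0 + 1"
proof -
  have "norm a < norm a0 + 1 / 16" using norm_triangle_sub[of a a0] assms by linarith
  thus "norm (a + circ \<tau>) < norm a0 + norm b0 + 1" "norm (a - circ \<tau>) < norm b0 + norm a0 + 1"
    using norm_triangle_ineq[of a "circ \<tau>"] norm_triangle_ineq4[of a "circ \<tau>"] norm_circ[of \<tau>] norm_ge_zero[of b0]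
    by linarith+
qed

text \<open>Averaging over \<open>(a + t, b - t)\<close> with \<open>\<bar>t\<bar> = 1/8\<close> continues \<open>F\<close> through the exceptional
  parameters: inside the unit disc the mean value property applies in \<open>t\<close>.\<close>
lemma circ_mean_continuation:
  assumes c: "c \<notin> \<int>\<^sub>\<le>\<^sub>0" and int: "a0 - b0 \<in> \<int>"
    and H: "hyp_continuation c (norm a0 + norm b0 + 1) H"
    and ab: "norm (a - a0) < 1 / 16" "norm (b - b0) < 1 / 16"
  defines "G \<equiv> \<lambda>w. integral {0..1} (\<lambda>\<tau>. H (a + circ \<tau>) (b - circ \<tau>) w)"
  shows "G holomorphic_on slit_plane" "w \<in> ball 0 1 \<Longrightarrow> G w = hyp_series a b c w"
proof -
  have good: "(a + circ \<tau>) - (b - circ \<tau>) \<notin> \<int>" "norm (a + circ \<tau>) < norm a0 + norm b0 + 1"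
     "norm (b - circ \<tau>) < norm a0 + norm b0 + 1" for \<tau>
    using circ_nonint[OF int ab] circ_bound(1)[OF ab(1)] circ_bound(2)[OF ab(2)] by auto
  define X :: "(complex \<times> complex \<times> complex) set"
    where "X = {(a, b, w). a - b \<notin> \<int> \<and> norm a < norm a0 + norm b0 + 1 \<and> norm b < norm a0 + norm b0 + 1 \<and> w \<in> slit_plane}"
  have cont: "continuous_on X (\<lambda>x. H (fst x) (fst (snd x)) (snd (snd x)))"
    using H unfolding hyp_continuation_def X_def by (simp add: case_prod_beta)
  show "G holomorphic_on slit_plane"
    unfolding G_def
  proof (rule holomorphic_integral_param[OF open_slit_plane])
    have "continuous_on (slit_plane \<times> {0..1}) (\<lambda>y. (a + circ (snd y), b - circ (snd y), fst y))"
      by (intro continuous_intros)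
    moreover have "(\<lambda>y. (a + circ (snd y), b - circ (snd y), fst y)) ` (slit_plane \<times> {0..1}) \<subseteq> X"
      using good by (auto simp: X_def)
    ultimately have "continuous_on (slit_plane \<times> {0..1}) (\<lambda>y. H (fst (a + circ (snd y), b - circ (snd y), fst y))
         (fst (snd (a + circ (snd y), b - circ (snd y), fst y))) (snd (snd (a + circ (snd y), b - circ (snd y), fst y))))"
      by (rule continuous_on_compose2[OF cont])
    thus "continuous_on (slit_plane \<times> {0..1}) (\<lambda>(w, \<tau>). H (a + circ \<tau>) (b - circ \<tau>) w)"
      by (simp only: case_prod_beta' fst_conv snd_conv)
    show "(\<lambda>w. H (a + circ \<tau>) (b - circ \<tau>) w) holomorphic_on slit_plane" for \<tau>
      using H good[of \<tau>] unfolding hyp_continuation_def by blast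
  qed
  assume w: "w \<in> ball 0 1"
  have "G w = integral {0..1} (\<lambda>\<tau>. hyp_series (a + circ \<tau>) (b - circ \<tau>) c w)"
    unfolding G_def using H good w unfolding hyp_continuation_def
    by (intro arg_cong[of _ _ "integral {0..1}"] ext) blast
  also have "\<dots> = hyp_series (a + 0) (b - 0) c w"
    by (rule circle_mean_value[of "\<lambda>t. hyp_series (a + t) (b - t) c w"])
       (use holomorphic_hyp_series_param[OF c] w in auto)
  finally show "G w = hyp_series a b c w" by simp
qed

section \<open>Identification of the continuation with \<open>hyp2f1\<close>\<close>

lemma hyp2f1_continuation_exists:
  assumes c: "c \<notin> \<int>\<^sub>\<le>\<^sub>0"
  shows "\<exists>F. F holomorphic_on slit_plane \<and> (\<forall>w\<in>ball 0 1. F w = hyp_series a b c w)"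
proof (cases "a - b \<in> \<int>")
  case False
  obtain H where H: "hyp_continuation c (norm a + norm b + 1) H"
    using hyp_continuation_exists[OF c] by blast
  have "norm a < norm a + norm b + 1" "norm b < norm a + norm b + 1"
    by (simp_all add: add_nonneg_pos add_pos_nonneg)
  thus ?thesis using H False unfolding hyp_continuation_def by (intro exI[of _ "H a b"]) blast
next
  case True
  obtain H where H: "hyp_continuation c (norm a + norm b + 1) H"
    using hyp_continuation_exists[OF c] by blast
  show ?thesis using circ_mean_continuation[OF c True H, of a b] by auto
qed

text \<open>Existence of a continuation is what gives the choice operator in \<open>hyp2f1\<close>
  its defining properties.\<close>

lemma hyp2f1_props:
  assumes c: "c \<notin> \<int>\<^sub>\<le>\<^sub>0"
  shows "hyp2f1 a b c holomorphic_on slit_plane"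
    and "w \<in> ball 0 1 \<Longrightarrow> hyp2f1 a b c w = hyp_series a b c w"
proof -
  let ?P = "\<lambda>F. F holomorphic_on slit_plane \<and> (\<forall>w\<in>ball 0 1.
     (\<lambda>n. pochhammer a n * pochhammer b n / pochhammer c n * (w ^ n / fact n)) sums F w)"
  have coeff: "(\<lambda>n. pochhammer a n * pochhammer b n / pochhammer c n * (w ^ n / fact n)) = (\<lambda>n. hyp_coeff a b c n * w ^ n)" for w
    by (simp add: hyp_coeff_def)
  have sums: "(\<lambda>n. hyp_coeff a b c n * w ^ n) sums hyp_series a b c w" if "w \<in> ball 0 1" for w
    using hyp_series_sums[OF c] that by simp
  obtain F where "F holomorphic_on slit_plane" "\<forall>w\<in>ball 0 1. F w = hyp_series a b c w"
    using hyp2f1_continuation_exists[OF c] by blast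
  hence "?P F" using sums unfolding coeff by simp
  hence P: "?P (hyp2f1 a b c)" unfolding hyp2f1_def by (rule someI[of ?P])
  thus "hyp2f1 a b c holomorphic_on slit_plane" by blast
  show "hyp2f1 a b c w = hyp_series a b c w" if "w \<in> ball 0 1"
    using P sums[OF that] that unfolding coeff by (blast intro: sums_unique2)
qed

lemma hyp2f1_unique:
  assumes c: "c \<notin> \<int>\<^sub>\<le>\<^sub>0" and G: "G holomorphic_on slit_plane"
    "\<And>w. w \<in> ball 0 1 \<Longrightarrow> G w = hyp_series a b c w" and w: "w \<in> slit_plane"
  shows "hyp2f1 a b c w = G w"
proof (rule analytic_continuation_open[of "ball 0 1" slit_plane "hyp2f1 a b c" G w])
  show "ball 0 1 \<subseteq> slit_plane" unfolding slit_plane_eq by blast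
  show "hyp2f1 a b c z = G z" if "z \<in> ball 0 1" for z
    using hyp2f1_props(2)[OF c that] G(2)[OF that] by simp
qed (fact open_ball open_slit_plane connected_slit_plane hyp2f1_props(1)[OF c] G(1) w | simp)+

subsection \<open>Limits on the cut\<close>

text \<open>Ln (- w) jumps across the cut, whereas Ln w minus s i pi is continuous through
  \<epsilon> = 0 and still a logarithm of - w. Since the modulus of w exceeds 1, it stays in the
  right half-plane.\<close>

lemma log_side_of_cut:
  fixes x s \<epsilon> :: real
  assumes "x > 1"
  shows "Re (Ln (of_real x + of_real s * \<i> * of_real \<epsilon>) - of_real s * \<i> * of_real pi) > 0"
    and "continuous_on UNIV (\<lambda>\<epsilon>::real. Ln (of_real x + of_real s * \<i> * of_real \<epsilon>) - of_real s * \<i> * of_real pi)"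
proof -
  define w where "w = of_real x + of_real s * \<i> * complex_of_real \<epsilon>"
  have "norm w > 1" using complex_Re_le_cmod[of w] assms by (simp add: w_def)
  moreover from this have "w \<noteq> 0" by auto
  ultimately show "Re (Ln (of_real x + of_real s * \<i> * of_real \<epsilon>) - of_real s * \<i> * of_real pi) > 0"
    by (simp add: w_def[symmetric] Re_Ln)
  have "of_real x + of_real s * \<i> * of_real \<epsilon> \<notin> \<real>\<^sub>\<le>\<^sub>0" for \<epsilon> :: real
    using assms by (auto simp: complex_nonpos_Reals_iff)
  thus "continuous_on UNIV (\<lambda>\<epsilon>::real. Ln (of_real x + of_real s * \<i> * of_real \<epsilon>) - of_real s * \<i> * of_real pi)"
    by (intro continuous_intros) auto
qed

lemma side_of_cut:
  assumes "x > 1" "\<epsilon> > 0" "s = 1 \<or> s = (-1::real)"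
  defines "w \<equiv> of_real x + of_real s * \<i> * of_real \<epsilon>"
  defines "\<zeta> \<equiv> Ln w - of_real s * \<i> * of_real pi"
  shows "- exp \<zeta> = w" "\<bar>Im \<zeta>\<bar> < pi" "Re \<zeta> > 0"
proof -
  have w: "Re w = x" "Im w = s * \<epsilon>" by (simp_all add: w_def)
  have w0: "w \<noteq> 0" using w assms by (metis not_one_less_zero zero_complex.sel(1))
  have "exp (of_real s * \<i> * of_real pi) = -1"
    using assms(3) by (auto simp: exp_minus exp_pi_i')
  thus "- exp \<zeta> = w" using w0 by (simp add: \<zeta>_def exp_diff)
  have "norm w > 1" using complex_Re_le_cmod[of w] w assms by linarith
  thus "Re \<zeta> > 0" using w0 by (simp add: \<zeta>_def Re_Ln)
  have "Im \<zeta> = Im (Ln w) - s * pi" by (simp add: \<zeta>_def)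
  moreover have "- pi < Im (Ln w)" "Im (Ln w) \<le> pi" using mpi_less_Im_Ln[OF w0] Im_Ln_le_pi[OF w0] .
  moreover have "s = 1 \<Longrightarrow> Im (Ln w) > 0" using Im_Ln_pos_lt_imp[of w] w assms(2) by simp
  moreover have "s = -1 \<Longrightarrow> Im (Ln w) < 0"
    using Im_Ln_pos_le[OF w0] Im_Ln_le_pi[OF w0] w assms(2) by auto
  ultimately show "\<bar>Im \<zeta>\<bar> < pi" using assms(3) by auto
qed

text \<open>The phases of the formula come from exp (- a \<zeta>) at \<zeta> = ln x - s i pi, while
  - exp (- \<zeta>) is 1 / x.\<close>

lemma hyp_right_on_cut:
  assumes ab: "a - b \<notin> \<int>" and x: "x > 1" and s: "s = 1 \<or> s = (-1::real)"
  shows "hyp_right a b c (Ln (of_real x) - of_real s * \<i> * of_real pi) =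
           Gamma c * Gamma (b - a) / (Gamma b * Gamma (c - a))
             * exp (of_real s * \<i> * of_real pi * a) * of_real x powr (- a)
             * hyp2f1 a (a - c + 1) (a - b + 1) (1 / of_real x)
         + Gamma c * Gamma (a - b) / (Gamma a * Gamma (c - b))
             * exp (of_real s * \<i> * of_real pi * b) * of_real x powr (- b)
             * hyp2f1 b (b - c + 1) (b - a + 1) (1 / of_real x)"
proof -
  have ba: "b - a \<notin> \<int>" using minus_notin_Ints_commute[OF ab] .
  have x0: "complex_of_real x \<noteq> 0" using x by simp
  have e: "exp (of_real s * \<i> * of_real pi) = -1"
    using s by (auto simp: exp_minus exp_pi_i')
  have *: "conn a b c * hyp_inf a b c (Ln (of_real x) - of_real s * \<i> * of_real pi) =
       Gamma c * Gamma (b - a) / (Gamma b * Gamma (c - a))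
             * exp (of_real s * \<i> * of_real pi * a) * of_real x powr (- a)
             * hyp2f1 a (a - c + 1) (a - b + 1) (1 / of_real x)" if ab: "a - b \<notin> \<int>" for a b
  proof -
    have "- exp (- (Ln (of_real x) - of_real s * \<i> * of_real pi)) = 1 / complex_of_real x"
      using x0 e by (simp add: exp_diff)
    moreover have "hyp2f1 a (a - c + 1) (a - b + 1) (1 / of_real x) = hyp_series a (a - c + 1) (a - b + 1) (1 / of_real x)"
      by (rule hyp2f1_props(2)[OF nonint_diff[OF ab]]) (use x in \<open>simp add: norm_divide\<close>)
    moreover have "exp (- a * (Ln (of_real x) - of_real s * \<i> * of_real pi)) = exp (of_real s * \<i> * of_real pi * a) * of_real x powr (- a)"
      using x0 unfolding powr_def by (simp flip: exp_add) (simp add: algebra_simps)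
    \<comment> \<open>\<open>Gamma\<close> is 0 at its poles and division by 0 gives 0, so the
      quotients agree with \<open>rGamma\<close> there too.\<close>
    ultimately show ?thesis
      unfolding hyp_inf_altdef conn_def by (simp add: rGamma_inverse_Gamma divide_inverse mult_ac)
  qed
  show ?thesis unfolding hyp_right_def *[OF ab] *[OF ba] ..
qed

text \<open>For \<epsilon> > 0 the point \<zeta> lies in the strip, where \<open>hyp2f1\<close>
  equals \<open>hyp_right\<close>. At \<epsilon> = 0 it reaches the edge of the strip, but
  \<open>hyp_right\<close> is continuous there because only Re \<zeta> > 0 matters.\<close>

lemma hyp2f1_cut_nonint:
  assumes c: "c \<notin> \<int>\<^sub>\<le>\<^sub>0" and ab: "a - b \<notin> \<int>" and x: "x > 1" and s: "s = 1 \<or> s = (-1::real)"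
  shows "((\<lambda>\<epsilon>. hyp2f1 a b c (of_real x + of_real s * \<i> * of_real \<epsilon>)) \<longlongrightarrow>
            hyp_right a b c (Ln (of_real x) - of_real s * \<i> * of_real pi)) (at_right 0)"
proof -
  obtain H where H: "hyp_continuation c (norm a + norm b + 1) H"
    using hyp_continuation_exists[OF c] by blast
  have B: "norm a < norm a + norm b + 1" "norm b < norm a + norm b + 1"
    by (simp_all add: add_nonneg_pos add_pos_nonneg)
  define \<zeta> where "\<zeta> = (\<lambda>\<epsilon>::real. Ln (of_real x + of_real s * \<i> * of_real \<epsilon>) - of_real s * \<i> * of_real pi)"
  have Re: "Re (\<zeta> \<epsilon>) > 0" and cz: "continuous_on UNIV \<zeta>" for \<epsilon>
    unfolding \<zeta>_def by (fact log_side_of_cut[OF x])+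
  have "continuous_on UNIV (\<lambda>\<epsilon>. hyp_right a b c (\<zeta> \<epsilon>))"
  proof (intro continuous_on_hyp_right continuous_intros)
  qed (use ab cz Re in \<open>auto intro: less_imp_le\<close>)
  hence "((\<lambda>\<epsilon>. hyp_right a b c (\<zeta> \<epsilon>)) \<longlongrightarrow> hyp_right a b c (\<zeta> 0)) (at 0)"
    by (simp add: continuous_on_def)
  hence "((\<lambda>\<epsilon>. hyp_right a b c (\<zeta> \<epsilon>)) \<longlongrightarrow> hyp_right a b c (\<zeta> 0)) (at_right 0)"
    using tendsto_within_subset by blast
  moreover have "eventually (\<lambda>\<epsilon>. hyp_right a b c (\<zeta> \<epsilon>) = hyp2f1 a b c (of_real x + of_real s * \<i> * of_real \<epsilon>)) (at_right 0)"
    using eventually_at_right_less[of 0]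
  proof eventually_elim
    case (elim \<epsilon>)
    have side: "- exp (\<zeta> \<epsilon>) = of_real x + of_real s * \<i> * of_real \<epsilon>" "\<bar>Im (\<zeta> \<epsilon>)\<bar> < pi" "Re (\<zeta> \<epsilon>) > 0"
      unfolding \<zeta>_def by (fact side_of_cut[OF x elim s])+
    have "hyp2f1 a b c (- exp (\<zeta> \<epsilon>)) = H a b (- exp (\<zeta> \<epsilon>))"
      by (rule hyp2f1_unique[OF c _ _ exp_slit_plane[OF side(2)]])
         (use H ab B in \<open>unfold hyp_continuation_def, blast+\<close>)
    also have "\<dots> = hyp_right a b c (\<zeta> \<epsilon>)"
      using H ab B side unfolding hyp_continuation_def by blast
    finally show ?case unfolding side(1) by (rule sym)
  qed
  ultimately have "((\<lambda>\<epsilon>. hyp2f1 a b c (of_real x + of_real s * \<i> * of_real \<epsilon>)) \<longlongrightarrow> hyp_right a b c (\<zeta> 0)) (at_right 0)"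
    by (rule Lim_transform_eventually)
  thus ?thesis by (simp add: \<zeta>_def)
qed

text \<open>Near (a0, b0) the function above or below the cut is one integral of
  \<open>hyp_right\<close> over shifted parameters, jointly continuous in (a, b, \<epsilon>). This
  gives the boundary values and their continuity in (a, b) together.\<close>

lemma hyp2f1_cut_int:
  assumes c: "c \<notin> \<int>\<^sub>\<le>\<^sub>0" and int: "a0 - b0 \<in> \<int>" and x: "x > 1" and s: "s = 1 \<or> s = (-1::real)"
  obtains L where
    "\<And>a b. norm (a - a0) < 1 / 16 \<Longrightarrow> norm (b - b0) < 1 / 16 \<Longrightarrow>
      ((\<lambda>\<epsilon>. hyp2f1 a b c (of_real x + of_real s * \<i> * of_real \<epsilon>)) \<longlongrightarrow> L a b) (at_right 0)"
    "((\<lambda>(a, b). L a b) \<longlongrightarrow> L a0 b0) (at (a0, b0))"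
proof -
  obtain H where H: "hyp_continuation c (norm a0 + norm b0 + 1) H"
    using hyp_continuation_exists[OF c] by blast
  define \<zeta> where "\<zeta> = (\<lambda>\<epsilon>::real. Ln (of_real x + of_real s * \<i> * of_real \<epsilon>) - of_real s * \<i> * of_real pi)"
  have Re: "Re (\<zeta> \<epsilon>) > 0" and cz: "continuous_on UNIV \<zeta>" for \<epsilon>
    unfolding \<zeta>_def by (fact log_side_of_cut[OF x])+
  \<comment> \<open>\<epsilon> may range over all reals, since Re \<zeta> > 0 for each of them; so
    \<epsilon> = 0 is an interior point.\<close>
  define U where "U = (ball a0 (1 / 16) \<times> ball b0 (1 / 16)) \<times> (UNIV :: real set)"
  define P where "P = (\<lambda>y::(complex \<times> complex) \<times> real. integral (cbox 0 1)
      (\<lambda>\<tau>. hyp_right (fst (fst y) + circ \<tau>) (snd (fst y) - circ \<tau>) c (\<zeta> (snd y))))"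
  have "continuous_on (U \<times> cbox (0::real) (1::real)) (\<lambda>z. hyp_right (fst (fst (fst z)) + circ (snd z)) (snd (fst (fst z)) - circ (snd z)) c (\<zeta> (snd (fst z))))"
  proof (intro continuous_on_hyp_right)
    show "continuous_on (U \<times> cbox (0::real) (1::real)) (\<lambda>z. fst (fst (fst z)) + circ (snd z))"
         "continuous_on (U \<times> cbox (0::real) (1::real)) (\<lambda>z. snd (fst (fst z)) - circ (snd z))"
      by (intro continuous_intros)+
    show "continuous_on (U \<times> cbox (0::real) (1::real)) (\<lambda>z. \<zeta> (snd (fst z)))"
      by (rule continuous_on_compose2[OF cz]) (auto intro!: continuous_intros)
    fix z assume "z \<in> U \<times> cbox (0::real) (1::real)"
    hence "norm (fst (fst (fst z)) - a0) < 1 / 16" "norm (snd (fst (fst z)) - b0) < 1 / 16"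
      by (auto simp: U_def dist_norm norm_minus_commute)
    from circ_nonint[OF int this] show "fst (fst (fst z)) + circ (snd z) - (snd (fst (fst z)) - circ (snd z)) \<notin> \<int>" .
  qed (use Re in \<open>auto intro: less_imp_le\<close>)
  hence contP: "continuous_on U P" unfolding P_def
    by (intro integral_continuous_on_param) (simp add: case_prod_beta)
  have "open U" by (auto simp: U_def intro!: open_Times)
  define L where "L = (\<lambda>a b. P ((a, b), 0))"
  have lim: "((\<lambda>\<epsilon>. hyp2f1 a b c (of_real x + of_real s * \<i> * of_real \<epsilon>)) \<longlongrightarrow> L a b) (at_right 0)"
    if ab: "norm (a - a0) < 1 / 16" "norm (b - b0) < 1 / 16" for a b
  proof -
    have U: "((a, b), \<epsilon>) \<in> U" for \<epsilon> using ab by (simp add: U_def dist_norm norm_minus_commute)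
    have "continuous_on UNIV (\<lambda>\<epsilon>. P ((a, b), \<epsilon>))"
      by (rule continuous_on_compose2[OF contP]) (auto intro!: continuous_intros simp: U)
    hence "((\<lambda>\<epsilon>. P ((a, b), \<epsilon>)) \<longlongrightarrow> L a b) (at 0)" by (simp add: continuous_on_def L_def)
    hence "((\<lambda>\<epsilon>. P ((a, b), \<epsilon>)) \<longlongrightarrow> L a b) (at_right 0)"
      using tendsto_within_subset by blast
    moreover have "eventually (\<lambda>\<epsilon>. P ((a, b), \<epsilon>) = hyp2f1 a b c (of_real x + of_real s * \<i> * of_real \<epsilon>)) (at_right 0)"
      using eventually_at_right_less[of 0]
    proof eventually_elim
      case (elim \<epsilon>)
      have side: "- exp (\<zeta> \<epsilon>) = of_real x + of_real s * \<i> * of_real \<epsilon>" "\<bar>Im (\<zeta> \<epsilon>)\<bar> < pi" "Re (\<zeta> \<epsilon>) > 0"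
      unfolding \<zeta>_def by (fact side_of_cut[OF x elim s])+
      have good: "(a + circ \<tau>) - (b - circ \<tau>) \<notin> \<int>" "norm (a + circ \<tau>) < norm a0 + norm b0 + 1"
         "norm (b - circ \<tau>) < norm a0 + norm b0 + 1" for \<tau>
        using circ_nonint[OF int ab] circ_bound(1)[OF ab(1)] circ_bound(2)[OF ab(2)] by auto
      have "hyp2f1 a b c (- exp (\<zeta> \<epsilon>)) = integral {0..1} (\<lambda>\<tau>. H (a + circ \<tau>) (b - circ \<tau>) (- exp (\<zeta> \<epsilon>)))"
        by (rule hyp2f1_unique[OF c, where G = "\<lambda>w. integral {0..1} (\<lambda>\<tau>. H (a + circ \<tau>) (b - circ \<tau>) w)"])
           (fact circ_mean_continuation[OF c int H ab] exp_slit_plane[OF side(2)])+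
      also have "\<dots> = P ((a, b), \<epsilon>)"
      proof -
        have "H (a + circ \<tau>) (b - circ \<tau>) (- exp (\<zeta> \<epsilon>)) = hyp_right (a + circ \<tau>) (b - circ \<tau>) c (\<zeta> \<epsilon>)" for \<tau>
          using H good side(2,3) unfolding hyp_continuation_def by blast
        thus ?thesis unfolding P_def by (simp only: fst_conv snd_conv box_real)
      qed
      finally show ?case unfolding side(1) by (rule sym)
    qed
    ultimately show ?thesis by (rule Lim_transform_eventually)
  qed
  have "continuous_on (ball a0 (1 / 16) \<times> ball b0 (1 / 16)) (\<lambda>p. P (p, 0))"
    by (rule continuous_on_compose2[OF contP]) (auto intro!: continuous_intros simp: U_def)
  moreover have "open (ball a0 (1 / 16) \<times> ball b0 (1 / 16))" by (intro open_Times) auto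
  moreover have "(a0, b0) \<in> ball a0 (1 / 16) \<times> ball b0 (1 / 16)" by simp
  ultimately have "isCont (\<lambda>p. P (p, 0)) (a0, b0)"
    using continuous_on_eq_continuous_at by blast
  hence "((\<lambda>(a, b). L a b) \<longlongrightarrow> L a0 b0) (at (a0, b0))"
    unfolding isCont_def L_def by (simp add: case_prod_beta')
  with lim show ?thesis using that by blast
qed

text \<open>For integer a - b at least one of Gamma (b - a) and Gamma (a - b) has a pole, so the
  right-hand side is read as its limit through parameters with nonintegral difference.\<close>

theorem theoremB1:
  fixes a b c :: complex and x s :: real
  assumes c: "c \<notin> \<int>\<^sub>\<le>\<^sub>0"
    and x: "x > 1"
    and sign: "s = 1 \<or> s = -1"
  shows
    "let R = (\<lambda>a b.
           Gamma c * Gamma (b - a) / (Gamma b * Gamma (c - a))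
             * exp (of_real s * \<i> * of_real pi * a) * of_real x powr (- a)
             * hyp2f1 a (a - c + 1) (a - b + 1) (1 / of_real x)
         + Gamma c * Gamma (a - b) / (Gamma a * Gamma (c - b))
             * exp (of_real s * \<i> * of_real pi * b) * of_real x powr (- b)
             * hyp2f1 b (b - c + 1) (b - a + 1) (1 / of_real x))
     in
       (a - b \<notin> \<int> \<longrightarrow>
          ((\<lambda>\<epsilon>. hyp2f1 a b c (of_real x + of_real s * \<i> * of_real \<epsilon>)) \<longlongrightarrow> R a b) (at_right 0))
     \<and> (a - b \<in> \<int> \<longrightarrow>
          (\<exists>L. ((\<lambda>\<epsilon>. hyp2f1 a b c (of_real x + of_real s * \<i> * of_real \<epsilon>)) \<longlongrightarrow> L) (at_right 0)
             \<and> ((\<lambda>(a', b'). R a' b') \<longlongrightarrow> L) (at (a, b) within {(a', b'). a' - b' \<notin> \<int>})))"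
proof -
  define R where "R = (\<lambda>a b.
           Gamma c * Gamma (b - a) / (Gamma b * Gamma (c - a))
             * exp (of_real s * \<i> * of_real pi * a) * of_real x powr (- a)
             * hyp2f1 a (a - c + 1) (a - b + 1) (1 / of_real x)
         + Gamma c * Gamma (a - b) / (Gamma a * Gamma (c - b))
             * exp (of_real s * \<i> * of_real pi * b) * of_real x powr (- b)
             * hyp2f1 b (b - c + 1) (b - a + 1) (1 / of_real x))"
  have nonint: "((\<lambda>\<epsilon>. hyp2f1 a b c (of_real x + of_real s * \<i> * of_real \<epsilon>)) \<longlongrightarrow> R a b) (at_right 0)"
    if "a - b \<notin> \<int>" for a b
    using hyp2f1_cut_nonint[OF c that x sign] unfolding hyp_right_on_cut[OF that x sign] R_def .
  have int: "\<exists>L. ((\<lambda>\<epsilon>. hyp2f1 a b c (of_real x + of_real s * \<i> * of_real \<epsilon>)) \<longlongrightarrow> L) (at_right 0)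
             \<and> ((\<lambda>(a', b'). R a' b') \<longlongrightarrow> L) (at (a, b) within {(a', b'). a' - b' \<notin> \<int>})"
    if ab: "a - b \<in> \<int>"
  proof -
    obtain L where L: "\<And>a' b'. norm (a' - a) < 1 / 16 \<Longrightarrow> norm (b' - b) < 1 / 16 \<Longrightarrow>
        ((\<lambda>\<epsilon>. hyp2f1 a' b' c (of_real x + of_real s * \<i> * of_real \<epsilon>)) \<longlongrightarrow> L a' b') (at_right 0)"
      and cont: "((\<lambda>(a, b). L a b) \<longlongrightarrow> L a b) (at (a, b))"
      by (rule hyp2f1_cut_int[OF c ab x sign]) (rule that)
    let ?S = "{(a', b'). a' - b' \<notin> (\<int> :: complex set)}"
    have "((\<lambda>(a, b). L a b) \<longlongrightarrow> L a b) (at (a, b) within ?S)"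
      using cont tendsto_within_subset by blast
    moreover have "eventually (\<lambda>p. (case p of (a', b') \<Rightarrow> L a' b') = (case p of (a', b') \<Rightarrow> R a' b')) (at (a, b) within ?S)"
    proof -
      have "open (ball a (1 / 16) \<times> ball b (1 / 16))" by (intro open_Times) auto
      hence "eventually (\<lambda>p. p \<in> ball a (1 / 16) \<times> ball b (1 / 16)) (at (a, b) within ?S)"
        unfolding eventually_at_topological
        by (intro exI[of _ "ball a (1 / 16) \<times> ball b (1 / 16)"]) auto
      moreover have "eventually (\<lambda>p. p \<in> ?S) (at (a, b) within ?S)"
        by (simp add: eventually_at_filter)
      ultimately show ?thesis
      proof eventually_elim
        case (elim p)
        obtain a' b' where p: "p = (a', b')" by force
        have "norm (a' - a) < 1 / 16" "norm (b' - b) < 1 / 16" "a' - b' \<notin> \<int>"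
          using elim by (auto simp: p dist_norm norm_minus_commute)
        \<comment> \<open>Both are limits of the same \<open>hyp2f1 a' b' c\<close> along the same
          path.\<close>
        hence "L a' b' = R a' b'"
          using tendsto_unique[OF _ L nonint] by simp
        thus ?case by (simp add: p)
      qed
    qed
    ultimately have "((\<lambda>(a', b'). R a' b') \<longlongrightarrow> L a b) (at (a, b) within ?S)"
      by (rule Lim_transform_eventually)
    with L[of a b] show ?thesis by auto
  qed
  show ?thesis unfolding Let_def R_def[symmetric] using nonint int by blast
qed

end
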